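(* Let $A,B$ be real symmetric $4\times 4$ matrices defining quadrics $\mathcal A: X^TAX=0$, $\mathcal B: X^TBX=0$ in $\mathbb{PR}^3$ with $f(\lambda)=\det(\lambda A-B)$ not identically zero. If $f(\lambda)=0$ has two double roots with Segre characteristic $[2(11)]$, then the only possible index sequences (up to equivalence) are $\langle 2\,{\wr\wr}_{-}\,2||2\rangle$ (or its equivalent $\langle 2\,{\wr\wr}_{+}\,2||2\rangle$), $\langle 1\,{\wr\wr}_{+}\,1||3\rangle$ and $\langle 1\,{\wr\wr}_{-}\,1||3\rangle$. Furthermore: (1) when the index sequence is $\langle 2\,{\wr\wr}_{-}\,2||2\rangle$, the QSIC consists of a real conic and two real lines which intersect pairwise at three distinct real points; (2) when the index sequence is $\langle 1\,{\wr\wr}_{-}\,1||3\rangle$, the QSIC consists of a real conic and a pair of complex conjugate lines, and the conic and the pair of lines have no real point in common; (3) when the index sequence is $\langle 1\,{\wr\wr}_{+}\,1||3\rangle$, the QSIC consists of an imaginary conic and a pair of complex conjugate lines, and the conic and the pair of lines have no real point in common.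
   Context: $X=(x,y,z,w)^T$ homogeneous coordinates; QSIC $=\mathcal A\cap\mathcal B$. One may take $A$ nonsingular. Canonical form: for $A$ nonsingular there is a real invertible $Q$ with $Q^TAQ=\mathrm{diag}(\varepsilon_1E_1,\dots,\varepsilon_rE_r,E_{r+1},\dots,E_m)$, $Q^TBQ=\mathrm{diag}(\varepsilon_1E_1J_1,\dots,\varepsilon_rE_rJ_r,E_{r+1}J_{r+1},\dots,E_mJ_m)$, $J_1,\dots,J_r$ the real Jordan blocks of $A^{-1}B$ for real eigenvalues, $E_i$ anti-identity matrices, $\varepsilon_i\in\{\pm1\}$ uniquely determined (sign of $J_i$). Segre characteristic $[2(11)]$: one eigenvalue with a single $2\times2$ block, another with two $1\times1$ blocks. $\mathrm{Id}(\lambda)$ = number of positive eigenvalues of $\lambda A-B$. Index sequence $\langle s_0\sigma_1s_1\sigma_2s_2\rangle$: $s_j$ the values of $\mathrm{Id}$ on the intervals determined by the real roots; $\sigma_j$ lists the blocks of root $j$: $p$ copies of $\wr$ with subscript the block's sign for a $p\times p$ block ($p\ge2$), $|$ for each $1\times1$ block. Equivalence: induced by change of basis of the pencil (rotation, reversal, complement $s_j\mapsto4-s_j$ with sign reversal). A conic is real if it has infinitely many real points, imaginary otherwise. *)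

theory Defs
  imports "HOL-Analysis.Analysis" "HOL-Computational_Algebra.Polynomial"
begin

definition pencil_poly :: "real^4^4 \<Rightarrow> real^4^4 \<Rightarrow> real poly" where
  "pencil_poly A B = det (\<chi> i j. [: - (B$i$j), A$i$j :])"

definition charpoly :: "real^4^4 \<Rightarrow> real poly" where
  "charpoly M = det (\<chi> i j. [: - (M$i$j), (if i = j then 1 else 0) :])"

definition num_pos_eig :: "real^4^4 \<Rightarrow> nat" where
  "num_pos_eig M = (\<Sum>x\<in>{x::real. 0 < x \<and> poly (charpoly M) x = 0}. order x (charpoly M))"

definition Id :: "real^4^4 \<Rightarrow> real^4^4 \<Rightarrow> real \<Rightarrow> nat" where
  "Id A B l = num_pos_eig (l *\<^sub>R A - B)"

definition jordan_2_11 :: "complex \<Rightarrow> complex \<Rightarrow> complex^4^4" where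
  "jordan_2_11 z1 z2 = vector [vector [z1, 1, 0, 0], vector [0, z1, 0, 0],
                               vector [0, 0, z2, 0], vector [0, 0, 0, z2]]"

definition two_double_roots_segre_2_11 :: "real^4^4 \<Rightarrow> real^4^4 \<Rightarrow> bool" where
  "two_double_roots_segre_2_11 A B \<longleftrightarrow>
     (\<exists>z1 z2 :: complex. \<exists>P :: complex^4^4.
        z1 \<noteq> z2 \<and>
        {z. poly (map_poly complex_of_real (pencil_poly A B)) z = 0} = {z1, z2} \<and>
        order z1 (map_poly complex_of_real (pencil_poly A B)) = 2 \<and>
        order z2 (map_poly complex_of_real (pencil_poly A B)) = 2 \<and>
        invertible P \<and>
        map_matrix complex_of_real (matrix_inv A ** B) = P ** jordan_2_11 z1 z2 ** matrix_inv P)"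

text \<open>Canonical form of the pair (A,B) for Segre characteristic [2(11)]:
  Q^T A Q = diag(eps E_2, e2, e3), Q^T B Q = diag(eps E_2 J_2(r), e2 s, e3 s),
  where E_2 is the 2x2 anti-identity and J_2(r) = [[r,1],[0,r]].\<close>
definition canonA :: "real \<Rightarrow> real \<Rightarrow> real \<Rightarrow> real^4^4" where
  "canonA \<epsilon> e2 e3 = vector [vector [0, \<epsilon>, 0, 0], vector [\<epsilon>, 0, 0, 0],
                           vector [0, 0, e2, 0], vector [0, 0, 0, e3]]"

definition canonB :: "real \<Rightarrow> real \<Rightarrow> real \<Rightarrow> real \<Rightarrow> real \<Rightarrow> real^4^4" where
  "canonB \<epsilon> e2 e3 r s = vector [vector [0, \<epsilon> * r, 0, 0], vector [\<epsilon> * r, \<epsilon>, 0, 0],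
                               vector [0, 0, e2 * s, 0], vector [0, 0, 0, e3 * s]]"

definition canon_2_11 :: "real^4^4 \<Rightarrow> real^4^4 \<Rightarrow> real \<Rightarrow> real \<Rightarrow> real \<Rightarrow> real \<Rightarrow> real \<Rightarrow> bool" where
  "canon_2_11 A B r s \<epsilon> e2 e3 \<longleftrightarrow>
     r \<noteq> s \<and> \<epsilon> \<in> {1, -1} \<and> e2 \<in> {1, -1} \<and> e3 \<in> {1, -1} \<and>
     (\<exists>Q :: real^4^4. invertible Q \<and>
        transpose Q ** A ** Q = canonA \<epsilon> e2 e3 \<and>
        transpose Q ** B ** Q = canonB \<epsilon> e2 e3 r s)"

text \<open>Symbols of an index sequence: Wr eps is one wiggle with subscript eps (sign of its
  block), Bar is the symbol of a 1x1 block.\<close>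
datatype idx_sym = Wr int | Bar

text \<open>sigma describes the Jordan blocks of the real root r: a 2x2 block of sign eps gives
  two wiggles with subscript eps; two 1x1 blocks give two bars.\<close>
definition root_blocks :: "real^4^4 \<Rightarrow> real^4^4 \<Rightarrow> real \<Rightarrow> idx_sym list \<Rightarrow> bool" where
  "root_blocks A B r \<sigma> \<longleftrightarrow>
     (\<exists>\<epsilon>::int. \<sigma> = [Wr \<epsilon>, Wr \<epsilon>] \<and> (\<exists>s e2 e3. canon_2_11 A B r s (of_int \<epsilon>) e2 e3)) \<or>
     (\<sigma> = [Bar, Bar] \<and> (\<exists>s \<epsilon> e2 e3. canon_2_11 A B s r \<epsilon> e2 e3))"

definition index_seq ::
  "real^4^4 \<Rightarrow> real^4^4 \<Rightarrow> nat \<Rightarrow> idx_sym list \<Rightarrow> nat \<Rightarrow> idx_sym list \<Rightarrow> nat \<Rightarrow> bool" where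
  "index_seq A B s0 \<sigma>1 s1 \<sigma>2 s2 \<longleftrightarrow> det A \<noteq> 0 \<and>
     (\<exists>r1 r2. r1 < r2 \<and> {r. poly (pencil_poly A B) r = 0} = {r1, r2} \<and>
        (\<forall>l. l < r1 \<longrightarrow> Id A B l = s0) \<and>
        (\<forall>l. r1 < l \<and> l < r2 \<longrightarrow> Id A B l = s1) \<and>
        (\<forall>l. r2 < l \<longrightarrow> Id A B l = s2) \<and>
        root_blocks A B r1 \<sigma>1 \<and> root_blocks A B r2 \<sigma>2)"

definition pencil_basis_change :: "real^4^4 \<Rightarrow> real^4^4 \<Rightarrow> real^4^4 \<Rightarrow> real^4^4 \<Rightarrow> bool" where
  "pencil_basis_change A B A' B' \<longleftrightarrow>
     (\<exists>a b c d :: real. a * d - b * c \<noteq> 0 \<and> A' = a *\<^sub>R A + b *\<^sub>R B \<and> B' = c *\<^sub>R A + d *\<^sub>R B)"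

definition index_seq_equiv ::
  "real^4^4 \<Rightarrow> real^4^4 \<Rightarrow> nat \<Rightarrow> idx_sym list \<Rightarrow> nat \<Rightarrow> idx_sym list \<Rightarrow> nat \<Rightarrow> bool" where
  "index_seq_equiv A B s0 \<sigma>1 s1 \<sigma>2 s2 \<longleftrightarrow>
     (\<exists>A' B'. pencil_basis_change A B A' B' \<and> index_seq A' B' s0 \<sigma>1 s1 \<sigma>2 s2)"

text \<open>Points are nonzero vectors of complex^4 (homogeneous coordinates); all sets below are
  closed under nonzero complex scaling.\<close>

definition cv :: "real^4 \<Rightarrow> complex^4" where
  "cv Y = (\<chi> i. complex_of_real (Y$i))"

definition cconj :: "complex^4 \<Rightarrow> complex^4" where
  "cconj X = (\<chi> i. cnj (X$i))"

definition qf :: "real^4^4 \<Rightarrow> complex^4 \<Rightarrow> complex" where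
  "qf M X = (\<Sum>i\<in>UNIV. \<Sum>j\<in>UNIV. complex_of_real (M$i$j) * X$i * X$j)"

definition qsic :: "real^4^4 \<Rightarrow> real^4^4 \<Rightarrow> (complex^4) set" where
  "qsic A B = {X. X \<noteq> 0 \<and> qf A X = 0 \<and> qf B X = 0}"

definition cindep2 :: "complex^4 \<Rightarrow> complex^4 \<Rightarrow> bool" where
  "cindep2 P Q \<longleftrightarrow> (\<forall>a b. a *s P + b *s Q = 0 \<longrightarrow> a = 0 \<and> b = 0)"

definition cindep3 :: "complex^4 \<Rightarrow> complex^4 \<Rightarrow> complex^4 \<Rightarrow> bool" where
  "cindep3 P Q R \<longleftrightarrow> (\<forall>a b c. a *s P + b *s Q + c *s R = 0 \<longrightarrow> a = 0 \<and> b = 0 \<and> c = 0)"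

definition line_through :: "complex^4 \<Rightarrow> complex^4 \<Rightarrow> (complex^4) set" where
  "line_through P Q = {X. X \<noteq> 0 \<and> (\<exists>a b. X = a *s P + b *s Q)}"

definition is_line :: "(complex^4) set \<Rightarrow> bool" where
  "is_line L \<longleftrightarrow> (\<exists>P Q. cindep2 P Q \<and> L = line_through P Q)"

definition is_real_line :: "(complex^4) set \<Rightarrow> bool" where
  "is_real_line L \<longleftrightarrow> (\<exists>P Q :: real^4. cindep2 (cv P) (cv Q) \<and> L = line_through (cv P) (cv Q))"

definition conj_lines :: "(complex^4) set \<Rightarrow> (complex^4) set \<Rightarrow> bool" where
  "conj_lines L1 L2 \<longleftrightarrow> is_line L1 \<and> L2 = cconj ` L1 \<and> L1 \<noteq> L2"

definition is_conic :: "(complex^4) set \<Rightarrow> bool" where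
  "is_conic C \<longleftrightarrow> (\<exists>P0 P1 P2 :: complex^4. \<exists>M :: complex^3^3.
     cindep3 P0 P1 P2 \<and> transpose M = M \<and> det M \<noteq> 0 \<and>
     C = {X. X \<noteq> 0 \<and> (\<exists>t :: complex^3. X = t$1 *s P0 + t$2 *s P1 + t$3 *s P2 \<and>
                          (\<Sum>i\<in>UNIV. \<Sum>j\<in>UNIV. M$i$j * t$i * t$j) = 0)})"

text \<open>Real points of a set S, as points of real projective space (1-dim. real subspaces).\<close>
definition real_points :: "(complex^4) set \<Rightarrow> (real^4) set set" where
  "real_points S = {span {Y} | Y. Y \<noteq> 0 \<and> cv Y \<in> S}"

definition real_conic :: "(complex^4) set \<Rightarrow> bool" where
  "real_conic C \<longleftrightarrow> is_conic C \<and> infinite (real_points C)"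

definition imaginary_conic :: "(complex^4) set \<Rightarrow> bool" where
  "imaginary_conic C \<longleftrightarrow> is_conic C \<and> finite (real_points C)"

definition ppoint :: "real^4 \<Rightarrow> (complex^4) set" where
  "ppoint Y = {X. X \<noteq> 0 \<and> (\<exists>c. X = c *s cv Y)}"

end

(* Over the complex numbers conjugation forces both double roots r, s to be real. If q1, q2 is a real
   Jordan chain for r on which the form A is [[0,eps],[eps,0]], then M - s I (with M = A^-1 B) has
   image span {q1, q2}; as it is A-self-adjoint, it vanishes on the A-orthogonal complement of
   q1, q2, and an A-orthonormal basis of that complement completes the canonical form.
   By Sylvester's law of inertia Id can be read off any diagonalization of l A - B: the 2x2 block
   always contributes one positive eigenvalue, the two 1x1 blocks change sign at s. Replacing (A, B)
   by (A, -B) or (-A, -B) reduces to r < s and to the three listed sequences.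
   In canonical coordinates B - s A splits into two planes, one meeting A in two lines and the other
   in a conic; a change of the basis of the pencil does not change the base locus. *)
theory Submission
  imports Defs
begin

section \<open>Inertia of real symmetric matrices\<close>

text \<open>The minimal polynomial (x - z1)^2 (x - z2) is not symmetric in its roots, and this
  excludes a conjugate pair: conjugation would yield (x - z2)^2 (x - z1) as an annihilator as well.
  The complex Jordan chain need not be real. The real one is built inside the image of M - s I, from
  a vector on which the symmetric form sending (x, y) to the A-product of (M - r I)(M - s I) x and
  (M - s I) y does not vanish; the sign of its value is \<epsilon>. \<open>Id\<close> counts
  eigenvalues, which congruence does not preserve; only their signs survive, so every count passes
  through a comparison with an orthogonal diagonalization. \<open>Id\<close> does not see \<epsilon>
  at all: the counts determine \<open>e2\<close> and \<open>e3\<close> up to order, while \<epsilon>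
  enters through the subscript, whose definition demands a canonical form of the pair. An index
  sequence therefore brings with it the canonical coordinates in which the curve is computed, but
  for the transformed pencil instead of (A, B).\<close>

definition diag_mat :: "('n \<Rightarrow> real) \<Rightarrow> real^'n^'n" where
  "diag_mat d = (\<chi> i j. if i = j then d i else 0)"

text \<open>The Rayleigh quotient attains its maximum on the unit sphere of \<open>S\<close>. A
  maximizer is an eigenvector, because moving it along the residual \<open>f v - c v\<close> would
  otherwise increase the quotient to first order.\<close>

lemma self_adjoint_invariant_subspace_eigenvector:
  fixes f :: "'a::euclidean_space \<Rightarrow> 'a"
  assumes lin: "linear f" and sa: "\<And>x y. f x \<bullet> y = x \<bullet> f y"
    and S: "subspace S" "f ` S \<subseteq> S" and x0: "x0 \<in> S" "x0 \<noteq> 0"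
  shows "\<exists>v c. v \<in> S \<and> norm v = 1 \<and> f v = c *\<^sub>R v"
proof -
  interpret f: linear f by fact
  let ?K = "S \<inter> sphere 0 1"
  have "compact ?K"
    using closed_subspace[OF S(1)] by (simp add: closed_Int_compact)
  moreover have "x0 /\<^sub>R norm x0 \<in> ?K"
    using x0 S(1) by (auto simp: subspace_scale)
  moreover have "continuous_on ?K (\<lambda>x. x \<bullet> f x)"
    using lin by (intro continuous_intros linear_continuous_on linear_conv_bounded_linear[THEN iffD1])
  ultimately obtain v where v: "v \<in> ?K" and vmax: "\<And>x. x \<in> ?K \<Longrightarrow> x \<bullet> f x \<le> v \<bullet> f v"
    using continuous_attains_sup[of ?K "\<lambda>x. x \<bullet> f x"] by blast
  define c where "c = v \<bullet> f v"
  have bound: "x \<bullet> f x \<le> c * (x \<bullet> x)" if "x \<in> S" for x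
  proof (cases "x = 0")
    case False
    have "x /\<^sub>R norm x \<in> ?K"
      using that False S(1) by (auto simp: subspace_scale)
    from vmax[OF this] have "(x \<bullet> f x) / (norm x)^2 \<le> c"
      by (simp add: f.scale c_def power2_eq_square field_simps)
    then show ?thesis
      using False by (simp add: field_simps power2_norm_eq_inner)
  qed (use f.zero in simp)
  define w where "w = f v - c *\<^sub>R v"
  have wS: "w \<in> S"
    using v S unfolding w_def by (auto intro!: subspace_diff subspace_scale)
  define a where "a = w \<bullet> w"
  define k where "k = c * (w \<bullet> w) - w \<bullet> f w"
  have k0: "k \<ge> 0" using bound[OF wS] by (simp add: k_def)
  have vv: "v \<bullet> v = 1" using v by (simp add: norm_eq_1)
  \<comment> \<open>Maximality tested at \<open>v + t w\<close> and expanded in \<open>t\<close>: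
    the linear term is bounded by the quadratic one.\<close>
  have ineq: "2 * t * a \<le> t\<^sup>2 * k" for t
  proof -
    have "v + t *\<^sub>R w \<in> S" using v wS S(1) by (auto intro!: subspace_add subspace_scale)
    from bound[OF this]
    have "v \<bullet> f v + t * (v \<bullet> f w) + t * (w \<bullet> f v) + t\<^sup>2 * (w \<bullet> f w)
        \<le> c * (v \<bullet> v) + 2 * t * (c * (v \<bullet> w)) + t\<^sup>2 * (c * (w \<bullet> w))"
      by (simp add: f.add f.scale inner_add_left inner_add_right inner_commute[of w v]
          power2_eq_square algebra_simps)
    moreover have "v \<bullet> f w = w \<bullet> f v" by (metis sa inner_commute)
    moreover have "w \<bullet> f v = a + c * (v \<bullet> w)"
      by (simp add: a_def w_def inner_diff_left inner_diff_right inner_commute algebra_simps)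
    ultimately show ?thesis
      using vv by (simp add: k_def c_def[symmetric] algebra_simps)
  qed
  have "a = 0"
  proof (rule ccontr)
    assume "a \<noteq> 0"
    then have "a > 0" by (simp add: a_def)
    \<comment> \<open>Any positive \<open>t\<close> below 2 a / k contradicts \<open>ineq\<close>;
      the \<open>+ 1\<close> also covers \<open>k = 0\<close>.\<close>
    then have t: "a / (k + 1) > 0" using k0 by simp
    have "2 * a \<le> a / (k + 1) * k"
      using ineq[of "a / (k + 1)"] mult_le_cancel_left_pos[OF t, of "2 * a" "a / (k + 1) * k"]
      by (simp add: power2_eq_square mult_ac)
    also have "\<dots> \<le> a" using k0 \<open>a > 0\<close> by (simp add: divide_simps)
    finally show False using \<open>a > 0\<close> by simp
  qed
  then have "f v = c *\<^sub>R v" by (simp add: a_def w_def)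
  then show ?thesis using v by auto
qed

text \<open>By self-adjointness the orthogonal complement of the eigenvectors already found is
  invariant, and it is nonzero as long as fewer than \<open>DIM('a)\<close> have been
  chosen.\<close>

lemma self_adjoint_orthonormal_eigenvectors:
  fixes f :: "'a::euclidean_space \<Rightarrow> 'a"
  assumes lin: "linear f" and sa: "\<And>x y. f x \<bullet> y = x \<bullet> f y" and "k \<le> DIM('a)"
  shows "\<exists>B. finite B \<and> card B = k \<and> pairwise orthogonal B \<and>
    (\<forall>b\<in>B. norm b = 1 \<and> (\<exists>c. f b = c *\<^sub>R b))"
  using \<open>k \<le> DIM('a)\<close>
proof (induction k)
  case 0
  then show ?case by (intro exI[of _ "{}"]) auto
next
  case (Suc k)
  then obtain B where B: "finite B" "card B = k" "pairwise orthogonal B"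
    and B1: "\<And>b. b \<in> B \<Longrightarrow> norm b = 1" and Be: "\<And>b. b \<in> B \<Longrightarrow> \<exists>c. f b = c *\<^sub>R b"
    by auto
  let ?S = "{x. \<forall>b\<in>B. orthogonal b x}"
  have "dim B < DIM('a)"
    using B dim_le_card'[OF B(1)] Suc.prems by simp
  then obtain x0 where x0: "x0 \<noteq> 0" "\<And>y. y \<in> span B \<Longrightarrow> orthogonal x0 y"
    using orthogonal_to_subspace_exists by blast
  have "f ` ?S \<subseteq> ?S"
  proof clarify
    fix x b assume x: "\<forall>b\<in>B. orthogonal b x" and b: "b \<in> B"
    obtain c where "f b = c *\<^sub>R b" using Be b by blast
    then show "orthogonal b (f x)"
      using x b sa[of b x] by (simp add: orthogonal_def)
  qed
  moreover have "subspace ?S" by (auto simp: subspace_def orthogonal_clauses)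
  moreover have "x0 \<in> ?S" using x0 by (simp add: orthogonal_commute span_base)
  ultimately obtain v c where v: "v \<in> ?S" "norm v = 1" "f v = c *\<^sub>R v"
    using self_adjoint_invariant_subspace_eigenvector[OF lin sa, of ?S x0] x0(1) by blast
  have "v \<notin> B" using v by (auto simp: orthogonal_self)
  then show ?case
    using B B1 Be v
    by (intro exI[of _ "insert v B"]) (auto simp: pairwise_insert orthogonal_commute)
qed

text \<open>Reads a congruent matrix as the Gram matrix of the columns of \<open>Q\<close>, so that
  a basis adapted to a form can be turned into a normal form entry by entry.\<close>

lemma congruence_entry:
  fixes M Q :: "real^'n^'n"
  shows "(transpose Q ** M ** Q) $ i $ j = column i Q \<bullet> (M *v column j Q)"
  unfolding matrix_mul_assoc[symmetric]
  by (simp add: matrix_matrix_mult_def matrix_vector_mult_def inner_vec_def column_def transpose_def)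

lemma symmetric_self_adjoint:
  fixes M :: "real^'n^'n"
  assumes "transpose M = M"
  shows "(M *v x) \<bullet> y = x \<bullet> (M *v y)"
  by (metis assms dot_lmul_matrix inner_commute vector_transpose_matrix)

theorem symmetric_matrix_diagonalization:
  fixes M :: "real^'n^'n"
  assumes "transpose M = M"
  obtains U :: "real^'n^'n" and d where "transpose U ** U = mat 1" "transpose U ** M ** U = diag_mat d"
proof -
  obtain B :: "(real^'n) set" where B: "finite B" "card B = CARD('n)" "pairwise orthogonal B"
    and B1: "\<And>b. b \<in> B \<Longrightarrow> norm b = 1" and "\<And>b. b \<in> B \<Longrightarrow> \<exists>c. M *v b = c *\<^sub>R b"
    using self_adjoint_orthonormal_eigenvectors[of "(*v) M" "CARD('n)"]
      symmetric_self_adjoint[OF assms] by (auto simp: DIM_cart)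
  then obtain c where c: "\<And>b. b \<in> B \<Longrightarrow> M *v b = c b *\<^sub>R b" by metis
  obtain h :: "'n \<Rightarrow> real^'n" where h: "bij_betw h UNIV B"
    using B bij_betw_iff_card[of "UNIV :: 'n set" B] by auto
  define U :: "real^'n^'n" where "U = (\<chi> i j. h j $ i)"
  have col: "column j U = h j" for j by (simp add: column_def U_def vec_eq_iff)
  have hB: "h j \<in> B" for j using h by (auto simp: bij_betw_def)
  have ip: "h i \<bullet> h j = (if i = j then 1 else 0)" for i j
  proof (cases "i = j")
    case True
    then show ?thesis using B1[OF hB, of j] by (simp add: norm_eq_1)
  next
    case False
    then have "h i \<noteq> h j" using h by (auto simp: bij_betw_def inj_on_def)
    then show ?thesis using B(3) hB False by (auto simp: pairwise_def orthogonal_def)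
  qed
  \<comment> \<open>Orthonormality is the case of the identity form, so one entry formula serves
    both equations.\<close>
  have "transpose U ** mat 1 ** U = mat 1"
    unfolding vec_eq_iff congruence_entry matrix_vector_mul_lid by (simp add: col ip mat_def)
  moreover have "transpose U ** M ** U = diag_mat (\<lambda>j. c (h j))"
    by (simp add: vec_eq_iff congruence_entry col ip c[OF hB] diag_mat_def)
  ultimately show ?thesis using that[of U] by simp
qed

section \<open>Positive eigenvalues and Sylvester's law of inertia\<close>

lemma poly_det:
  fixes P :: "'a::comm_ring_1 poly^'n^'n"
  shows "poly (det P) x = det (\<chi> i j. poly (P$i$j) x)"
  by (simp add: det_def poly_sum poly_prod)

lemma poly_charpoly: "poly (charpoly M) x = det (x *\<^sub>R mat 1 - M)"
  unfolding charpoly_def poly_det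
  by (rule arg_cong[where f = det]) (simp add: vec_eq_iff mat_def)

lemma poly_pencil_poly: "poly (pencil_poly A B) x = det (x *\<^sub>R A - B)"
  unfolding pencil_poly_def poly_det
  by (rule arg_cong[where f = det]) (simp add: vec_eq_iff)

lemma congruence_pencil:
  fixes A B Q :: "real^'n^'n"
  shows "transpose Q ** (a *\<^sub>R A - B) ** Q
    = a *\<^sub>R (transpose Q ** A ** Q) - transpose Q ** B ** Q"
  by (simp add: vec_eq_iff matrix_matrix_mult_def sum_subtractf sum_distrib_left sum_distrib_right
      algebra_simps)

text \<open>For an orthogonal \<open>U\<close> congruence is similarity, so the characteristic
  polynomial is the product of the factors x - d i, and the order of a root is the number of indices
  with that value.\<close>

lemma num_pos_eig_orthogonal_diag:
  fixes U M :: "real^4^4"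
  assumes U: "transpose U ** U = mat 1" and M: "transpose U ** M ** U = diag_mat d"
  shows "num_pos_eig M = card {i. d i > 0}"
proof -
  have "poly (charpoly M) x = (\<Prod>i\<in>UNIV. x - d i)" for x
  proof -
    have "det (transpose U) * det U = 1"
      using U det_mul[of "transpose U" U] by simp
    then have "poly (charpoly M) x = det (transpose U ** (x *\<^sub>R mat 1 - M) ** U)"
      by (simp add: poly_charpoly det_mul mult_ac)
    also have "transpose U ** (x *\<^sub>R mat 1 - M) ** U = diag_mat (\<lambda>i. x - d i)"
      unfolding congruence_pencil matrix_mul_rid U M by (simp add: diag_mat_def mat_def vec_eq_iff)
    also have "det \<dots> = (\<Prod>i\<in>UNIV. x - d i)"
      by (subst det_diagonal) (auto simp: diag_mat_def)
    finally show ?thesis .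
  qed
  then have cp: "charpoly M = (\<Prod>i\<in>UNIV. [:- d i, 1:])"
    by (intro poly_eq_poly_eq_iff[THEN iffD1] ext) (simp add: poly_prod)
  have ord: "order x (charpoly M) = card {i. d i = x}" for x
  proof -
    have "order x (charpoly M) = (\<Sum>i\<in>UNIV. order x [:- d i, 1:])"
      unfolding cp
      using finite[of "UNIV :: 4 set"]
      by (induction rule: finite_induct) (auto simp: order_mult order_0I simp del: mult_pCons_left)
    also have "order x [:- d i, 1:] = (if d i = x then 1 else 0)" for i
      using order_power_n_n[of x 1] by (auto intro: order_0I)
    then have "(\<Sum>i\<in>UNIV. order x [:- d i, 1:]) = card {i. d i = x}"
      by (simp add: sum.If_cases)
    finally show ?thesis .
  qed
  have roots: "{x. 0 < x \<and> poly (charpoly M) x = 0} = d ` {i. d i > 0}"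
    unfolding cp by (auto simp: poly_prod)
  have "num_pos_eig M = (\<Sum>x\<in>d ` {i. d i > 0}. card {i. d i = x})"
    unfolding num_pos_eig_def roots ord ..
  also have "\<dots> = card (\<Union>x\<in>d ` {i. d i > 0}. {i. d i = x})"
    by (rule card_UN_disjoint[symmetric]) auto
  also have "(\<Union>x\<in>d ` {i. d i > 0}. {i. d i = x}) = {i. d i > 0}" by auto
  finally show ?thesis .
qed

lemma diag_mat_mult: "diag_mat d *v x = (\<chi> i. d i * x $ i)"
  by (simp add: diag_mat_def matrix_vector_mult_def vec_eq_iff if_distrib if_distribR cong: if_cong)

text \<open>One half of the law of inertia. The space where \<open>e\<close> is positive is carried
  by \<open>S\<close> into one that meets the space where \<open>d\<close> is nonpositive only in 0;
  comparing dimensions gives the bound.\<close>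

lemma congruent_diag_card_pos_le:
  fixes S :: "real^'n^'n"
  assumes S: "invertible S" and eq: "transpose S ** diag_mat d ** S = diag_mat e"
  shows "card {i. e i > 0} \<le> card {i. d i > 0}"
proof -
  define V where "V = {x :: real^'n. \<forall>i. \<not> e i > 0 \<longrightarrow> x $ i = 0}"
  define W where "W = {x :: real^'n. \<forall>i. d i > 0 \<longrightarrow> x $ i = 0}"
  have V: "subspace V" "V = {x. \<forall>i\<in>UNIV. i \<notin> {i. e i > 0} \<longrightarrow> x $ i = 0}"
    by (auto simp: V_def subspace_def)
  have W: "subspace W" "W = {x. \<forall>i\<in>UNIV. i \<notin> {i. \<not> d i > 0} \<longrightarrow> x $ i = 0}"
    by (auto simp: W_def subspace_def)
  have dV: "dim V = card {i. e i > 0}" "dim W = card {i. \<not> d i > 0}"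
    using dim_substandard_cart[where 'a=real and d="{i. e i > 0}"]
      dim_substandard_cart[where 'a=real and d="{i. \<not> d i > 0}"]
    by (simp_all add: V_def W_def dim_vec_eq)
  have inj: "inj ((*v) S)" using S by (simp add: inj_matrix_vector_mult)
  have "dim ((*v) S ` V) = dim V"
    by (rule dim_image_eq) (auto intro: inj_on_subset[OF inj])
  moreover have "(*v) S ` V \<inter> W \<subseteq> {0}"
  proof
    fix y assume "y \<in> (*v) S ` V \<inter> W"
    then obtain x where x: "x \<in> V" "y = S *v x" and yW: "y \<in> W" by auto
    \<comment> \<open>A single value of the form, nonnegative in the coordinates of \<open>x\<close>
      and nonpositive in those of \<open>y\<close>.\<close>
    have "x \<bullet> (diag_mat e *v x) = y \<bullet> (diag_mat d *v y)"
      unfolding x eq[symmetric] matrix_vector_mul_assoc[symmetric]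
      by (metis dot_lmul_matrix vector_transpose_matrix transpose_transpose)
    moreover have "y $ i * (d i * y $ i) \<le> 0" for i
    proof (cases "d i > 0")
      case False
      then have "d i * (y $ i)\<^sup>2 \<le> 0" by (simp add: mult_nonpos_nonneg)
      then show ?thesis by (simp add: power2_eq_square mult_ac)
    qed (use yW in \<open>simp add: W_def\<close>)
    then have "y \<bullet> (diag_mat d *v y) \<le> 0"
      by (simp add: inner_vec_def diag_mat_mult sum_nonpos)
    ultimately have le: "(\<Sum>i\<in>UNIV. e i * (x $ i)\<^sup>2) \<le> 0"
      by (simp add: inner_vec_def diag_mat_mult power2_eq_square mult_ac)
    have nn: "e i * (x $ i)\<^sup>2 \<ge> 0" for i
      using x(1) by (cases "e i > 0") (auto simp: V_def)
    have "e i * (x $ i)\<^sup>2 = 0" for i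
      using sum_nonneg_eq_0_iff[of UNIV "\<lambda>i. e i * (x $ i)\<^sup>2"] nn le sum_nonneg[of UNIV "\<lambda>i. e i * (x $ i)\<^sup>2"]
      by auto
    then have ex: "e i = 0 \<or> x $ i = 0" for i by simp
    have "x $ i = 0" for i using x(1) ex[of i] by (cases "e i > 0") (auto simp: V_def)
    then have "x = 0" by (simp add: vec_eq_iff)
    then show "y \<in> {0}" by (simp add: x)
  qed
  ultimately have "card {i. e i > 0} + card {i. \<not> d i > 0} \<le> CARD('n)"
  proof -
    have "subspace ((*v) S ` V)" by (simp add: V(1) linear_subspace_image)
    moreover have "(*v) S ` V \<inter> W = {0}"
      using \<open>(*v) S ` V \<inter> W \<subseteq> {0}\<close> subspace_0[OF \<open>subspace ((*v) S ` V)\<close>] subspace_0[OF W(1)] by blast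
    ultimately have "dim {x + y |x y. x \<in> (*v) S ` V \<and> y \<in> W} = dim ((*v) S ` V) + dim W"
      using dim_sums_Int[OF _ W(1), of "(*v) S ` V"] by simp
    moreover have "dim {x + y |x y. x \<in> (*v) S ` V \<and> y \<in> W} \<le> CARD('n)"
      by (rule dim_subset_UNIV_cart)
    ultimately show ?thesis using dV \<open>dim ((*v) S ` V) = dim V\<close> by simp
  qed
  moreover have "card {i. d i > 0} + card {i. \<not> d i > 0} = CARD('n)"
  proof -
    have "{i. d i > 0} \<union> {i. \<not> d i > 0} = UNIV" by auto
    moreover have "{i. d i > 0} \<inter> {i. \<not> d i > 0} = {}" by auto
    ultimately show ?thesis
      using card_Un_disjoint[OF finite finite, of "{i. d i > 0}" "{i. \<not> d i > 0}"] by presburger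
  qed
  ultimately show ?thesis by linarith
qed

text \<open>\<open>R\<close> and an orthogonal \<open>U\<close> give two diagonal forms of
  \<open>M\<close>; \<open>transpose U ** R\<close> and \<open>R' ** U\<close> carry one into the
  other, so the inequality applies in both directions. The orthogonal form is the one that links the
  count to the eigenvalues.\<close>

theorem num_pos_eig_congruent_diag:
  fixes M R :: "real^4^4"
  assumes sym: "transpose M = M" and R: "invertible R" and eq: "transpose R ** M ** R = diag_mat e"
  shows "num_pos_eig M = card {i. e i > 0}"
proof -
  obtain U :: "real^4^4" and d where U: "transpose U ** U = mat 1" and d: "transpose U ** M ** U = diag_mat d"
    using symmetric_matrix_diagonalization[OF sym] .
  have UU: "U ** transpose U = mat 1" using U by (simp add: matrix_left_right_inverse)
  have iU: "invertible U" "invertible (transpose U)" using U UU by (auto simp: invertible_def)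
  have "U ** diag_mat d ** transpose U = (U ** transpose U) ** M ** (U ** transpose U)"
    unfolding d[symmetric] by (simp add: matrix_mul_assoc)
  then have M: "M = U ** diag_mat d ** transpose U" by (simp add: UU)
  obtain R' where R': "R ** R' = mat 1" "R' ** R = mat 1"
    using R by (auto simp: invertible_def)
  have "transpose (transpose U ** R) ** diag_mat d ** (transpose U ** R) = diag_mat e"
    using eq M by (simp add: matrix_transpose_mul matrix_mul_assoc)
  then have "card {i. e i > 0} \<le> card {i. d i > 0}"
    using congruent_diag_card_pos_le invertible_mult iU(2) R by blast
  moreover have "transpose (R' ** U) ** diag_mat e ** (R' ** U) = diag_mat d"
  proof -
    have "transpose (R' ** U) ** diag_mat e ** (R' ** U)
      = transpose U ** (transpose (R ** R')) ** M ** (R ** R') ** U"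
      unfolding eq[symmetric] by (simp add: matrix_transpose_mul matrix_mul_assoc)
    then show ?thesis using R' d by (simp add: transpose_mat)
  qed
  then have "card {i. d i > 0} \<le> card {i. e i > 0}"
    using congruent_diag_card_pos_le[of "R' ** U"] invertible_mult[of R' U] iU(1) R'
    by (auto simp: invertible_def)
  ultimately show ?thesis
    using num_pos_eig_orthogonal_diag[OF U d] by simp
qed

section \<open>From the complex Jordan form to real generalized eigenvectors\<close>

lemma vector_4:
  "(vector [x, y, z, w] :: 'a::zero^4) $ 1 = x" "(vector [x, y, z, w] :: 'a::zero^4) $ 2 = y"
  "(vector [x, y, z, w] :: 'a::zero^4) $ 3 = z" "(vector [x, y, z, w] :: 'a::zero^4) $ 4 = w"
  by (simp_all add: vector_def)

lemma matrix_add_rdistrib: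
  fixes X Y :: "'a::semiring_1^'n^'m" and Z :: "'a^'p^'n"
  shows "(X + Y) ** Z = X ** Z + Y ** Z"
  by (simp add: vec_eq_iff matrix_matrix_mult_def algebra_simps sum.distrib)

lemma mat_vector_mul: "(mat c :: 'a::comm_ring_1^'n^'n) *v x = c *s x"
  by (simp add: vec_eq_iff matrix_vector_mult_def mat_def if_distrib if_distribR cong: if_cong)

lemma invertible_matrix_inv:
  fixes P :: "'a::field^'n^'n"
  assumes "invertible P"
  shows "P ** matrix_inv P = mat 1" "matrix_inv P ** P = mat 1"
  using someI_ex[OF assms[unfolded invertible_def]] unfolding matrix_inv_def by auto

text \<open>Covers both entrywise maps in use, the embedding of the reals and complex
  conjugation.\<close>

lemma map_matrix_mult:
  fixes X Y :: "'a::semiring_1^'n^'n" and f :: "'a \<Rightarrow> 'b::semiring_1"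
  assumes "f 0 = 0" "\<And>x y. f (x + y) = f x + f y" "\<And>x y. f (x * y) = f x * f y"
  shows "map_matrix f (X ** Y) = map_matrix f X ** map_matrix f Y"
proof -
  have "f (sum g S) = (\<Sum>i\<in>S. f (g i))" if "finite S" for g and S :: "'n set"
    using that by (induction S) (auto simp: assms)
  then show ?thesis
    by (simp add: vec_eq_iff map_matrix_def matrix_matrix_mult_def assms)
qed

lemmas map_matrix_of_real_mult = map_matrix_mult[where f = complex_of_real, simplified]
lemmas map_matrix_cnj_mult = map_matrix_mult[where f = cnj, simplified]

lemma map_matrix_of_real_mult_cv:
  "map_matrix complex_of_real M *v cv x = cv (M *v x)"
  by (simp add: vec_eq_iff cv_def matrix_vector_mult_def map_matrix_def)

text \<open>Together with the next lemma: for distinct roots the minimal polynomial is (x - z1)^2 (x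
  - z2), whose exponents tell the roots apart.\<close>

lemma jordan_2_11_annihilator:
  "(jordan_2_11 z1 z2 - mat z1) ** (jordan_2_11 z1 z2 - mat z1) ** (jordan_2_11 z1 z2 - mat z2) = 0"
  by (simp add: vec_eq_iff forall_4 matrix_matrix_mult_def sum_4 jordan_2_11_def mat_def vector_4)

lemma jordan_2_11_not_annihilator:
  assumes "z1 \<noteq> z2"
  shows "(jordan_2_11 z1 z2 - mat z1) ** (jordan_2_11 z1 z2 - mat z2) \<noteq> 0"
proof
  assume "(jordan_2_11 z1 z2 - mat z1) ** (jordan_2_11 z1 z2 - mat z2) = 0"
  \<comment> \<open>The entry (1, 2) of this product is z1 - z2.\<close>
  then have "((jordan_2_11 z1 z2 - mat z1) ** (jordan_2_11 z1 z2 - mat z2)) $ 1 $ 2 = 0" by simp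
  then show False
    using assms by (simp add: matrix_matrix_mult_def sum_4 jordan_2_11_def mat_def vector_4)
qed

lemma mat_mul_row: "((mat k :: 'a::comm_ring_1^'n^'n) ** X) $ i = k *s X $ i"
  by (simp add: vec_eq_iff matrix_matrix_mult_def mat_def if_distrib if_distribR cong: if_cong)

lemma mat_commute: "(mat k :: 'a::comm_ring_1^'n^'n) ** X = X ** mat k"
  by (simp add: vec_eq_iff matrix_matrix_mult_def mat_def if_distrib if_distribR mult.commute cong: if_cong)

lemma sub_mat_commute:
  fixes X :: "'a::comm_ring_1^'n^'n"
  shows "(X - mat a) ** (X - mat b) = (X - mat b) ** (X - mat a)"
proof -
  have eq: "X - mat a = (X - mat b) + mat (b - a)" by (simp add: vec_eq_iff mat_def)
  show ?thesis
    unfolding eq matrix_add_ldistrib matrix_add_rdistrib by (simp only: mat_commute)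
qed

lemma similar_sub_mat:
  fixes P :: "'a::field^'n^'n"
  assumes "invertible P"
  shows "P ** J ** matrix_inv P - mat z = P ** (J - mat z) ** matrix_inv P"
proof -
  have "P ** (J - mat z) ** matrix_inv P = P ** J ** matrix_inv P - P ** mat z ** matrix_inv P"
    by (simp add: vec_eq_iff matrix_matrix_mult_def sum_subtractf sum_distrib_right algebra_simps)
  also have "P ** mat z = mat z ** P" by (rule mat_commute[symmetric])
  finally show ?thesis
    by (simp add: invertible_matrix_inv[OF assms] matrix_mul_assoc[symmetric])
qed

text \<open>Extracts what can be brought down to the reals: polynomial identities in
  \<open>C\<close>, which conjugation transports, and a chain whose span contains the image of
  \<open>C - mat z2\<close>.\<close>

lemma segre_2_11_jordan_chain:
  assumes "two_double_roots_segre_2_11 A B"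
  defines "C \<equiv> map_matrix complex_of_real (matrix_inv A ** B)"
  obtains z1 z2 p1 p2 where "z1 \<noteq> z2"
    "{z. poly (map_poly complex_of_real (pencil_poly A B)) z = 0} = {z1, z2}"
    "(C - mat z1) ** (C - mat z1) ** (C - mat z2) = 0"
    "(C - mat z1) ** (C - mat z2) \<noteq> 0"
    "p1 \<noteq> 0" "(C - mat z1) *v p1 = 0" "(C - mat z1) *v p2 = p1"
    "\<forall>x. \<exists>a b. (C - mat z2) *v x = a *s p1 + b *s p2"
proof -
  obtain z1 z2 P where z: "z1 \<noteq> z2"
    "{z. poly (map_poly complex_of_real (pencil_poly A B)) z = 0} = {z1, z2}"
    and P: "invertible P" and C: "C = P ** jordan_2_11 z1 z2 ** matrix_inv P"
    using assms(1) unfolding two_double_roots_segre_2_11_def C_def by blast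
  let ?J = "jordan_2_11 z1 z2"
  note inv = invertible_matrix_inv[OF P]
  have C': "C - mat z = P ** (?J - mat z) ** matrix_inv P" for z
    unfolding C by (rule similar_sub_mat[OF P])
  have cancel: "P ** X ** matrix_inv P ** (P ** Y ** matrix_inv P) = P ** (X ** Y) ** matrix_inv P"
    for X Y
  proof -
    have "P ** X ** matrix_inv P ** (P ** Y ** matrix_inv P)
        = P ** X ** (matrix_inv P ** P) ** Y ** matrix_inv P"
      by (simp only: matrix_mul_assoc)
    then show ?thesis by (simp add: inv matrix_mul_assoc)
  qed
  have unconj: "matrix_inv P ** (P ** X ** matrix_inv P) ** P = X" for X
  proof -
    have "matrix_inv P ** (P ** X ** matrix_inv P) ** P
        = (matrix_inv P ** P) ** X ** (matrix_inv P ** P)"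
      by (simp only: matrix_mul_assoc)
    then show ?thesis by (simp add: inv)
  qed
  have "(C - mat z1) ** (C - mat z1) ** (C - mat z2) = P ** 0 ** matrix_inv P"
    unfolding C' cancel jordan_2_11_annihilator ..
  then have 1: "(C - mat z1) ** (C - mat z1) ** (C - mat z2) = 0"
    by (simp add: vec_eq_iff matrix_matrix_mult_def)
  have 2: "(C - mat z1) ** (C - mat z2) \<noteq> 0"
  proof
    assume "(C - mat z1) ** (C - mat z2) = 0"
    then have "P ** ((?J - mat z1) ** (?J - mat z2)) ** matrix_inv P = 0"
      unfolding C' cancel .
    then have "(?J - mat z1) ** (?J - mat z2) = matrix_inv P ** 0 ** P"
      using unconj[of "(?J - mat z1) ** (?J - mat z2)"] by simp
    then show False
      using jordan_2_11_not_annihilator[OF z(1)]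
      by (simp add: vec_eq_iff matrix_matrix_mult_def)
  qed
  define p1 where "p1 = P *v axis 1 1"
  define p2 where "p2 = P *v axis 2 1"
  have CP: "(C - mat z) *v (P *v y) = P *v ((?J - mat z) *v y)" for z y
  proof -
    have "(C - mat z) ** P = P ** (?J - mat z) ** (matrix_inv P ** P)"
      unfolding C' by (simp only: matrix_mul_assoc)
    then show ?thesis by (simp add: inv matrix_vector_mul_assoc)
  qed
  have J1: "(?J - mat z1) *v axis 1 1 = 0" "(?J - mat z1) *v axis 2 1 = axis 1 1"
    by (simp_all add: vec_eq_iff forall_4 matrix_vector_mult_def sum_4 jordan_2_11_def mat_def
        vector_4 axis_def)
  \<comment> \<open>The two 1x1 blocks belong to \<open>z2\<close>, so only the first two
    coordinates survive; the witnesses are these coordinates.\<close>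
  have J2: "\<exists>a b. (?J - mat z2) *v y = a *s axis 1 1 + b *s axis 2 1" for y
    by (intro exI[of _ "(z1 - z2) * y $ 1 + y $ 2"] exI[of _ "(z1 - z2) * y $ 2"])
      (simp add: vec_eq_iff forall_4 matrix_vector_mult_def sum_4 jordan_2_11_def mat_def
        vector_4 axis_def)
  have "p1 \<noteq> 0"
  proof
    assume "p1 = 0"
    then have "matrix_inv P *v (P *v axis 1 1) = 0" by (simp add: p1_def)
    then have "axis 1 1 = (0 :: complex^4)" by (simp add: matrix_vector_mul_assoc inv)
    then show False by (simp add: axis_eq_0_iff)
  qed
  moreover have "(C - mat z1) *v p1 = 0" "(C - mat z1) *v p2 = p1"
    by (simp_all add: p1_def p2_def CP J1)
  moreover have "\<exists>a b. (C - mat z2) *v x = a *s p1 + b *s p2" for x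
  proof -
    have x: "x = P *v (matrix_inv P *v x)" by (simp add: matrix_vector_mul_assoc inv)
    obtain a b where "(?J - mat z2) *v (matrix_inv P *v x) = a *s axis 1 1 + b *s axis 2 1"
      using J2 by blast
    then have "(C - mat z2) *v x = a *s p1 + b *s p2"
      by (subst x, subst CP) (simp add: p1_def p2_def vec.add vec.scale matrix_vector_right_distrib
          vector_scalar_commute)
    then show ?thesis by blast
  qed
  ultimately show ?thesis using that z 1 2 by blast
qed

text \<open>\<open>p1\<close> and \<open>p2\<close> may be genuinely complex, so the last clause is
  conditional: whenever a real chain lies in the image of \<open>M - mat s\<close>, its span
  contains that image. The chain itself is constructed later with the help of the form.\<close>

lemma segre_2_11_real_chain:
  assumes "two_double_roots_segre_2_11 A B"
  defines "M \<equiv> matrix_inv A ** B"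
  obtains r s where "r \<noteq> s"
    "(M - mat r) ** (M - mat r) ** (M - mat s) = 0" "(M - mat r) ** (M - mat s) \<noteq> 0"
    "\<And>q1 q2 x. (M - mat r) *v q2 = q1 \<Longrightarrow> (M - mat r) *v q1 = 0 \<Longrightarrow> q1 \<noteq> 0 \<Longrightarrow>
      q1 \<in> range ((*v) (M - mat s)) \<Longrightarrow> q2 \<in> range ((*v) (M - mat s)) \<Longrightarrow>
      \<exists>a b. (M - mat s) *v x = a *\<^sub>R q1 + b *\<^sub>R q2"
proof -
  define C where "C = map_matrix complex_of_real M"
  obtain z1 z2 p1 p2 where z: "z1 \<noteq> z2"
    and roots: "{z. poly (map_poly complex_of_real (pencil_poly A B)) z = 0} = {z1, z2}"
    and C: "(C - mat z1) ** (C - mat z1) ** (C - mat z2) = 0"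
    "(C - mat z1) ** (C - mat z2) \<noteq> 0"
    and p: "p1 \<noteq> 0" "(C - mat z1) *v p1 = 0" "(C - mat z1) *v p2 = p1"
    and ran: "\<forall>x. \<exists>a b. (C - mat z2) *v x = a *s p1 + b *s p2"
    by (rule segre_2_11_jordan_chain[OF assms(1), folded M_def, folded C_def])
  have cnj_C: "map_matrix cnj (C - mat z) = C - mat (cnj z)" for z
    by (simp add: vec_eq_iff map_matrix_def C_def mat_def)
  have roots_cnj: "cnj z \<in> {z1, z2}" if "z \<in> {z1, z2}" for z
    using that unfolding roots[symmetric] by (simp add: real_poly_cnj_root_iff coeff_map_poly)
  \<comment> \<open>Otherwise conjugation swaps the roots and (C - z2)^2 (C - z1) vanishes too. The
    two annihilators differ by (z2 - z1) (C - z1) (C - z2), which would then be zero.\<close>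
  have "cnj z1 = z1"
  proof (rule ccontr)
    assume "cnj z1 \<noteq> z1"
    then have c: "cnj z1 = z2" "cnj z2 = z1" using roots_cnj[of z1] by auto
    have "(C - mat z2) ** (C - mat z2) ** (C - mat z1)
        = map_matrix cnj ((C - mat z1) ** (C - mat z1) ** (C - mat z2))"
      by (simp only: map_matrix_cnj_mult cnj_C c)
    then have "(C - mat z2) ** (C - mat z2) ** (C - mat z1) = 0"
      unfolding C(1) by (simp add: map_matrix_def vec_eq_iff)
    then have "(C - mat z2) ** (C - mat z1) ** (C - mat z2) = 0"
      unfolding matrix_mul_assoc[symmetric] by (simp only: sub_mat_commute[of C z2 z1])
    moreover have "(C - mat z1) ** W = (C - mat z2) ** W + mat (z2 - z1) ** W" for W
    proof -
      have "(C - mat z2) + mat (z2 - z1) = C - mat z1" by (simp add: vec_eq_iff mat_def)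
      then show ?thesis by (simp only: matrix_add_rdistrib[symmetric])
    qed
    from this[of "(C - mat z1) ** (C - mat z2)"]
    have "(C - mat z1) ** (C - mat z1) ** (C - mat z2)
        = (C - mat z2) ** (C - mat z1) ** (C - mat z2) + mat (z2 - z1) ** ((C - mat z1) ** (C - mat z2))"
      by (simp only: matrix_mul_assoc)
    ultimately have "mat (z2 - z1) ** ((C - mat z1) ** (C - mat z2)) = 0"
      using C(1) by (simp only: add_0)
    then have "(z2 - z1) *s ((C - mat z1) ** (C - mat z2)) $ i = 0" for i
      by (simp only: mat_mul_row[symmetric]) simp
    then show False using C(2) z by (simp add: vec_eq_iff)
  qed
  moreover have "cnj z2 = z2"
  proof -
    have "cnj z2 \<noteq> z1" using z \<open>cnj z1 = z1\<close> complex_cnj_cancel_iff by metis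
    then show ?thesis using roots_cnj[of z2] by auto
  qed
  ultimately obtain r s where rs: "z1 = complex_of_real r" "z2 = complex_of_real s"
    by (metis Reals_cnj_iff Reals_cases)
  have real_C: "C - mat (complex_of_real t) = map_matrix complex_of_real (M - mat t)" for t
    by (simp add: vec_eq_iff map_matrix_def C_def mat_def)
  have inj: "map_matrix complex_of_real X = 0 \<longleftrightarrow> X = 0" for X
    by (simp add: vec_eq_iff map_matrix_def)
  show ?thesis
  proof (rule that)
    show "r \<noteq> s" using z rs by auto
    show "(M - mat r) ** (M - mat r) ** (M - mat s) = 0" "(M - mat r) ** (M - mat s) \<noteq> 0"
      using C unfolding rs real_C map_matrix_of_real_mult[symmetric] inj by auto
  next
    fix q1 q2 x
    assume q: "(M - mat r) *v q2 = q1" "(M - mat r) *v q1 = 0" "q1 \<noteq> 0"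
      "q1 \<in> range ((*v) (M - mat s))" "q2 \<in> range ((*v) (M - mat s))"
    have cv: "(C - mat z1) *v cv q2 = cv q1" "(C - mat z1) *v cv q1 = 0"
      unfolding rs real_C map_matrix_of_real_mult_cv q by (simp_all add: vec_eq_iff cv_def)
    have ran': "\<exists>a b. cv ((M - mat s) *v y) = a *s p1 + b *s p2" for y
      using ran[rule_format, of "cv y"] unfolding rs real_C map_matrix_of_real_mult_cv .
    obtain a b where 1: "cv q1 = a *s p1 + b *s p2" using q(4) ran' by (elim imageE) blast
    obtain c d where 2: "cv q2 = c *s p1 + d *s p2" using q(5) ran' by (elim imageE) blast
    obtain e f where 3: "cv ((M - mat s) *v x) = e *s p1 + f *s p2" using ran' by blast
    have lin: "(C - mat z1) *v (a *s p1 + b *s p2) = b *s p1" for a b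
      by (simp add: vec.add vec.scale matrix_vector_right_distrib vector_scalar_commute p)
    have "b = 0" using cv(2) p(1) unfolding 1 lin by simp
    then have "d *s p1 = a *s p1" using cv(1) unfolding 1 2 lin by simp
    then have "d = a" using p(1) by (simp add: vector_mul_rcancel)
    have "cv q1 \<noteq> 0" using q(3) by (auto simp: cv_def vec_eq_iff)
    then have "a \<noteq> 0" using 1 \<open>b = 0\<close> by auto
    \<comment> \<open>Coordinates with respect to the chain, from the triangular system cv q1 = a
      p1, cv q2 = c p1 + a p2.\<close>
    define g where "g = e / a - f * c / a\<^sup>2"
    define h where "h = f / a"
    have "cv ((M - mat s) *v x) = g *s cv q1 + h *s cv q2"
      unfolding 1 2 3 using \<open>a \<noteq> 0\<close> \<open>b = 0\<close> \<open>d = a\<close>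
      by (simp add: vec_eq_iff g_def h_def field_simps power2_eq_square)
    \<comment> \<open>All three vectors are real, so the real parts of the complex coefficients
      serve as well.\<close>
    then have "(M - mat s) *v x = Re g *\<^sub>R q1 + Re h *\<^sub>R q2"
      by (simp add: vec_eq_iff cv_def complex_eq_iff)
    then show "\<exists>a b. (M - mat s) *v x = a *\<^sub>R q1 + b *\<^sub>R q2" by blast
  qed
qed

section \<open>The real canonical form of the pencil\<close>

lemma symmetric_form_commute:
  fixes A :: "real^'n^'n"
  assumes "transpose A = A"
  shows "x \<bullet> (A *v y) = y \<bullet> (A *v x)"
  by (metis assms inner_commute symmetric_self_adjoint)

text \<open>Testing with v = A w gives |A w|^2 = 0, and \<open>A\<close> is injective.\<close>

lemma nondegenerate_form:
  fixes A :: "real^'n^'n"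
  assumes "transpose A = A" "det A \<noteq> 0" "\<And>v. w \<bullet> (A *v v) = 0"
  shows "w = 0"
proof -
  have "A *v w = 0"
    using assms(3)[of "A *v w"] symmetric_self_adjoint[OF assms(1), of w "A *v w"] by simp
  moreover have "inj ((*v) A)"
    using assms(2) by (simp add: inj_matrix_vector_mult invertible_det_nz)
  ultimately show ?thesis by (metis injD matrix_vector_mult_0_right)
qed

text \<open>The hypothesis \<open>proj\<close> says that the form is nondegenerate on the span of \<open>S\<close>, so that it is
  nondegenerate on the orthogonal complement as well and cannot vanish identically there.\<close>
lemma orthogonal_unit_vector_exists:
  fixes A :: "real^'n^'n"
  assumes sym: "transpose A = A" and det: "det A \<noteq> 0"
    and S: "finite S" "card S < CARD('n)"
    and proj: "\<And>v. \<exists>u\<in>span S. \<forall>p\<in>S. (v - u) \<bullet> (A *v p) = 0"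
  shows "\<exists>w. (\<forall>p\<in>S. w \<bullet> (A *v p) = 0) \<and> w \<bullet> (A *v w) \<in> {1, -1}"
proof -
  define W where "W = {w. \<forall>p\<in>S. w \<bullet> (A *v p) = 0}"
  have W: "subspace W" by (auto simp: W_def subspace_def inner_add_left)
  have ortho: "w \<bullet> (A *v u) = 0" if "w \<in> W" "u \<in> span S" for w u
    using that(2)
  proof (induction rule: span_induct_alt)
    case (step c x y)
    then show ?case using that(1)
      by (simp add: W_def matrix_vector_right_distrib matrix_vector_mult_scaleR inner_add_right)
  qed simp
  have "dim ((\<lambda>p. A *v p) ` S) \<le> card ((\<lambda>p. A *v p) ` S)" using S by (intro dim_le_card') auto
  also have "\<dots> < CARD('n)" using card_image_le[OF S(1), of "\<lambda>p. A *v p"] S(2) by linarith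
  finally have "dim ((\<lambda>p. A *v p) ` S) < DIM(real^'n)" by simp
  then obtain w0 where w0: "w0 \<noteq> 0" "\<And>y. y \<in> span ((\<lambda>p. A *v p) ` S) \<Longrightarrow> orthogonal w0 y"
    using orthogonal_to_subspace_exists by blast
  have w0W: "w0 \<in> W" using w0(2) by (auto simp: W_def orthogonal_def span_base)
  \<comment> \<open>Were the form zero on \<open>W\<close>, polarization would make
    \<open>w0\<close> orthogonal to all of \<open>W\<close>; being orthogonal to
    \<open>span S\<close> as well, it would lie in the radical.\<close>
  have "\<exists>w\<in>W. w \<bullet> (A *v w) \<noteq> 0"
  proof (rule ccontr)
    assume "\<not> ?thesis"
    then have iso: "w \<bullet> (A *v w) = 0" if "w \<in> W" for w using that by blast
    have "w0 \<bullet> (A *v v) = 0" for v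
    proof -
      obtain u where u: "u \<in> span S" "\<forall>p\<in>S. (v - u) \<bullet> (A *v p) = 0" using proj by blast
      then have vu: "v - u \<in> W" by (simp add: W_def)
      have "w0 + (v - u) \<in> W" using W w0W vu by (rule subspace_add)
      from iso[OF this] iso[OF w0W] iso[OF vu] symmetric_form_commute[OF sym, of w0 "v - u"]
      have "w0 \<bullet> (A *v (v - u)) = 0"
        by (simp add: matrix_vector_right_distrib inner_add_left inner_add_right)
      then show ?thesis using ortho[OF w0W u(1)]
        by (simp add: matrix_vector_mult_diff_distrib inner_diff_right)
    qed
    then show False using nondegenerate_form[OF sym det] w0(1) by blast
  qed
  then obtain w where w: "w \<in> W" "w \<bullet> (A *v w) \<noteq> 0" by blast
  define k where "k = 1 / sqrt \<bar>w \<bullet> (A *v w)\<bar>"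
  have "(k *\<^sub>R w) \<bullet> (A *v (k *\<^sub>R w)) = k\<^sup>2 * (w \<bullet> (A *v w))"
    by (simp add: matrix_vector_mult_scaleR power2_eq_square)
  also have "\<dots> \<in> {1, -1}"
    using w(2) by (simp add: k_def power_divide field_simps abs_if)
  finally have "(k *\<^sub>R w) \<bullet> (A *v (k *\<^sub>R w)) \<in> {1, -1}" .
  moreover have "k *\<^sub>R w \<in> W" using W w(1) by (rule subspace_scale)
  ultimately show ?thesis unfolding W_def by blast
qed

lemma mat_sub_vector_mul:
  fixes M :: "real^'n^'n"
  shows "(M - mat t) *v x = M *v x - t *\<^sub>R x"
  by (simp add: matrix_vector_mult_diff_rdistrib mat_vector_mul scalar_mult_eq_scaleR)

lemma canonA_involution:
  assumes "\<epsilon> \<in> {1, -1}" "e2 \<in> {1, -1}" "e3 \<in> {1, -1}"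
  shows "canonA \<epsilon> e2 e3 ** canonA \<epsilon> e2 e3 = mat 1"
  using assms
  by (auto simp: vec_eq_iff forall_4 matrix_matrix_mult_def sum_4 canonA_def mat_def vector_4)

text \<open>\<open>canonA\<close> is its own inverse, so the congruence itself exhibits a left
  inverse of \<open>Q\<close>. Linear independence of the adapted basis follows from its Gram matrix
  in this way.\<close>

lemma congruent_canonA_invertible:
  fixes A Q :: "real^4^4"
  assumes "\<epsilon> \<in> {1, -1}" "e2 \<in> {1, -1}" "e3 \<in> {1, -1}"
    and "transpose Q ** A ** Q = canonA \<epsilon> e2 e3"
  shows "invertible Q"
proof -
  have "(canonA \<epsilon> e2 e3 ** transpose Q ** A) ** Q = mat 1"
    using canonA_involution[OF assms(1-3)] unfolding assms(4)[symmetric]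
    by (simp only: matrix_mul_assoc)
  then have "\<exists>X. X ** Q = mat 1" by blast
  then show ?thesis by (simp only: invertible_left_inverse)
qed

theorem segre_2_11_imp_canon:
  assumes symA: "transpose A = A" and symB: "transpose B = B" and det: "det A \<noteq> 0"
    and segre: "two_double_roots_segre_2_11 A B"
  shows "\<exists>r s \<epsilon> e2 e3. canon_2_11 A B r s \<epsilon> e2 e3"
proof -
  define M where "M = matrix_inv A ** B"
  have AM: "A ** M = B"
    using invertible_matrix_inv(1)[of A] det
    by (simp add: M_def matrix_mul_assoc invertible_det_nz)
  obtain r s where rs: "r \<noteq> s"
    and ann: "(M - mat r) ** (M - mat r) ** (M - mat s) = 0"
    and nann: "(M - mat r) ** (M - mat s) \<noteq> 0"
    and ran: "\<And>q1 q2 x. (M - mat r) *v q2 = q1 \<Longrightarrow> (M - mat r) *v q1 = 0 \<Longrightarrow> q1 \<noteq> 0 \<Longrightarrow>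
      q1 \<in> range ((*v) (M - mat s)) \<Longrightarrow> q2 \<in> range ((*v) (M - mat s)) \<Longrightarrow>
      \<exists>a b. (M - mat s) *v x = a *\<^sub>R q1 + b *\<^sub>R q2"
    using segre_2_11_real_chain[OF segre, folded M_def] by metis
  define g where "g x y = x \<bullet> (A *v y)" for x y
  define R where "R x = (M - mat r) *v x" for x
  define S where "S x = (M - mat s) *v x" for x
  have g_lin: "g (x + y) z = g x z + g y z" "g x (y + z) = g x y + g x z"
    "g (x - y) z = g x z - g y z" "g x (y - z) = g x y - g x z"
    "g (c *\<^sub>R x) y = c * g x y" "g x (c *\<^sub>R y) = c * g x y" for x y z c
    by (simp_all add: g_def inner_add_left inner_add_right inner_diff_left inner_diff_right
        matrix_vector_right_distrib matrix_vector_mult_diff_distrib matrix_vector_mult_scaleR)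
  have g_com: "g x y = g y x" for x y
    unfolding g_def by (rule symmetric_form_commute[OF symA])
  have g_nondeg: "x = 0" if "\<And>v. g x v = 0" for x
    using nondegenerate_form[OF symA det] that by (simp add: g_def)
  have gM: "g x (M *v y) = x \<bullet> (B *v y)" for x y
    by (simp add: g_def matrix_vector_mul_assoc AM)
  have gM_sa: "g (M *v x) y = g x (M *v y)" for x y
    using symmetric_form_commute[OF symB, of x y] g_com[of "M *v x" y] by (simp add: gM)
  have lin: "R (x + y) = R x + R y" "R (x - y) = R x - R y" "R (c *\<^sub>R x) = c *\<^sub>R R x"
    "S (x + y) = S x + S y" "S (x - y) = S x - S y" "S (c *\<^sub>R x) = c *\<^sub>R S x" for x y c
    by (simp_all add: R_def S_def matrix_vector_right_distrib matrix_vector_mult_diff_distrib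
        matrix_vector_mult_scaleR)
  have R: "R x = M *v x - r *\<^sub>R x" and S: "S x = M *v x - s *\<^sub>R x" for x
    by (simp_all add: R_def S_def mat_sub_vector_mul)
  have R_sa: "g (R x) y = g x (R y)" and S_sa: "g (S x) y = g x (S y)" for x y
    by (simp_all add: R S g_lin gM_sa)
  have RS: "R (S x) = S (R x)" for x
    by (simp add: R S matrix_vector_mult_diff_distrib matrix_vector_mult_scaleR algebra_simps)
  have RRS: "R (R (S x)) = 0" for x
    using arg_cong[OF ann, of "\<lambda>T. T *v x"] by (simp add: R_def S_def matrix_vector_mul_assoc matrix_mul_assoc)
  have "\<exists>x0. R (S x0) \<noteq> 0"
    using nann by (auto simp: R_def S_def matrix_vector_mul_assoc) (metis matrix_eq matrix_vector_mult_0)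
  then obtain x0 where x0: "R (S x0) \<noteq> 0" by blast
  \<comment> \<open>\<open>S - R\<close> is the scalar r - s, and \<open>R\<close> kills every
    \<open>R (S x)\<close>.\<close>
  have S_RS: "S (R (S x)) = (r - s) *\<^sub>R R (S x)" for x
  proof -
    have "S (R (S x)) - R (R (S x)) = (r - s) *\<^sub>R R (S x)"
      unfolding S[of "R (S x)"] R[of "R (S x)"] by (simp add: algebra_simps)
    then show ?thesis by (simp add: RRS)
  qed
  \<comment> \<open>On the diagonal this is the product of the two vectors of the chain
    \<open>R (S x)\<close>, \<open>S x\<close>, which must be nonzero if they are to span a
    hyperbolic plane.\<close>
  define h where "h x y = g (R (S x)) (S y)" for x y
  have h_com: "h x y = h y x" for x y
    unfolding h_def by (metis R_sa g_com)
  \<comment> \<open>If \<open>h\<close> vanished on the diagonal, polarization would make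
    \<open>S (R (S x0))\<close>, a nonzero multiple of \<open>R (S x0)\<close>, orthogonal to every
    vector.\<close>
  have "\<exists>x. h x x \<noteq> 0"
  proof (rule ccontr)
    assume "\<not> ?thesis"
    then have h0: "h x x = 0" for x by blast
    have "h x0 y = 0" for y
      using h0[of "x0 + y"] h0[of x0] h0[of y] h_com[of x0 y]
      by (simp add: h_def lin g_lin)
    then have "g (S (R (S x0))) y = 0" for y by (simp add: h_def S_sa)
    then have "S (R (S x0)) = 0" by (rule g_nondeg)
    then show False using S_RS[of x0] x0 rs by simp
  qed
  then obtain x1 where x1: "h x1 x1 \<noteq> 0" by blast
  \<comment> \<open>Rescaling leaves only the sign of \<open>h x1 x1\<close>, which becomes the sign
    of the block.\<close>
  define k where "k = 1 / sqrt \<bar>h x1 x1\<bar>"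
  define x where "x = k *\<^sub>R x1"
  define \<epsilon> where "\<epsilon> = h x x"
  have "\<epsilon> = k\<^sup>2 * h x1 x1"
    by (simp add: \<epsilon>_def x_def h_def lin g_lin power2_eq_square)
  then have \<epsilon>: "\<epsilon> \<in> {1, -1}"
    using x1 by (cases "h x1 x1 < 0") (simp_all add: k_def power_divide field_simps)
  then have \<epsilon>2: "\<epsilon> * \<epsilon> = 1" "\<epsilon> \<noteq> 0" by auto
  define q1 where "q1 = R (S x)"
  \<comment> \<open>Subtracting a multiple of \<open>q1\<close> keeps \<open>R q2 = q1\<close>. The
    factor 1/2 lets the two cross terms cancel \<open>g (S x) (S x)\<close>, as \<epsilon> is its
    own inverse.\<close>
  define q2 where "q2 = S x - (\<epsilon> * g (S x) (S x) / 2) *\<^sub>R q1"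
  have Rq1: "R q1 = 0" by (simp add: q1_def RRS)
  have Rq2: "R q2 = q1" by (simp add: q2_def lin Rq1) (simp add: q1_def)
  have g11: "g q1 q1 = 0"
    using R_sa[of "S x" q1] Rq1 g_com by (simp add: q1_def[symmetric] g_def)
  have g12: "g q1 q2 = \<epsilon>"
    by (simp add: q2_def g_lin g11) (simp add: q1_def \<epsilon>_def h_def)
  have g22: "g q2 q2 = 0"
  proof -
    have "g q1 (S x) = \<epsilon>" by (simp add: q1_def \<epsilon>_def h_def)
    then show ?thesis
      using \<epsilon>2 g_com[of "S x" q1] by (simp add: q2_def g_lin g11 algebra_simps)
  qed
  have q1: "q1 \<noteq> 0" using g12 \<epsilon>2 by (auto simp: g_def)
  \<comment> \<open>Both chain vectors are exhibited in the image of \<open>S\<close>, as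
    \<open>ran\<close> requires.\<close>
  have q1S: "q1 = S (R x)" by (simp add: q1_def RS)
  have q2S: "q2 = S (x - (\<epsilon> * g (S x) (S x) / 2) *\<^sub>R R x)"
    by (simp add: q2_def lin q1S)
  have rangeS: "\<exists>a b. S y = a *\<^sub>R q1 + b *\<^sub>R q2" for y
    using ran[of q2 q1 y] Rq1 Rq2 q1 q1S q2S unfolding R_def S_def by blast
  have S0: "S w = 0" if "g w q1 = 0" "g w q2 = 0" for w
  proof (rule g_nondeg)
    fix v
    obtain a b where "S v = a *\<^sub>R q1 + b *\<^sub>R q2" using rangeS by blast
    then show "g (S w) v = 0" using that by (simp add: S_sa g_lin)
  qed
  have g21: "g q2 q1 = \<epsilon>" using g12 g_com by simp
  \<comment> \<open>The \<open>g\<close>-orthogonal projection onto the plane of \<open>q1\<close>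
    and \<open>q2\<close>. Its coefficients are crossed because each of these isotropic vectors
    pairs only with the other.\<close>
  define pr where "pr v = (\<epsilon> * g v q2) *\<^sub>R q1 + (\<epsilon> * g v q1) *\<^sub>R q2" for v
  have pr: "g (v - pr v) q1 = 0" "g (v - pr v) q2 = 0" for v
    using \<epsilon>2(1) by (simp_all add: pr_def g_lin g11 g12 g21 g22 algebra_simps)
  have "\<exists>w. (\<forall>p\<in>{q1, q2}. w \<bullet> (A *v p) = 0) \<and> w \<bullet> (A *v w) \<in> {1, -1}"
  proof (rule orthogonal_unit_vector_exists[OF symA det])
    show "card {q1, q2} < CARD(4)" using card_insert_le_m1[of 2 "{q2}" q1] by simp
    fix v
    have "pr v \<in> span {q1, q2}" unfolding pr_def by (intro span_add span_scale span_base) auto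
    then show "\<exists>u\<in>span {q1, q2}. \<forall>p\<in>{q1, q2}. (v - u) \<bullet> (A *v p) = 0"
      using pr[of v] unfolding g_def by blast
  qed simp
  then obtain w2 where w2: "g w2 q1 = 0" "g w2 q2 = 0" "g w2 w2 \<in> {1, -1}"
    unfolding g_def by blast
  define e2 where "e2 = g w2 w2"
  have e2: "e2 * e2 = 1" using w2(3) by (auto simp: e2_def)
  have g_w2: "g q1 w2 = 0" "g q2 w2 = 0" using w2 g_com by simp_all
  have "\<exists>w. (\<forall>p\<in>{q1, q2, w2}. w \<bullet> (A *v p) = 0) \<and> w \<bullet> (A *v w) \<in> {1, -1}"
  proof (rule orthogonal_unit_vector_exists[OF symA det])
    show "card {q1, q2, w2} < CARD(4)"
      using card_insert_le_m1[of 3 "{q2, w2}" q1] card_insert_le_m1[of 2 "{w2}" q2] by simp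
    fix v
    let ?u = "pr v + (e2 * g v w2) *\<^sub>R w2"
    have "?u \<in> span {q1, q2, w2}" unfolding pr_def by (intro span_add span_scale span_base) auto
    moreover have "g (v - ?u) q1 = 0" "g (v - ?u) q2 = 0"
      using pr[of v] w2 by (simp_all add: g_lin)
    moreover have "g (v - ?u) w2 = 0"
      using e2 by (simp add: g_lin pr_def g_w2 e2_def[symmetric] algebra_simps)
    ultimately show "\<exists>u\<in>span {q1, q2, w2}. \<forall>p\<in>{q1, q2, w2}. (v - u) \<bullet> (A *v p) = 0"
      unfolding g_def by blast
  qed simp
  then obtain w3 where w3: "g w3 q1 = 0" "g w3 q2 = 0" "g w3 w2 = 0" "g w3 w3 \<in> {1, -1}"
    unfolding g_def by blast
  define e3 where "e3 = g w3 w3"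
  have g_w3: "g q1 w3 = 0" "g q2 w3 = 0" "g w2 w3 = 0" using w3 g_com by simp_all
  have M_eqs: "M *v q1 = r *\<^sub>R q1" "M *v q2 = r *\<^sub>R q2 + q1"
    "M *v w2 = s *\<^sub>R w2" "M *v w3 = s *\<^sub>R w3"
    using Rq1 Rq2 S0[OF w2(1,2)] S0[OF w3(1,2)] by (auto simp: R S algebra_simps)
  define Q :: "real^4^4" where "Q = transpose (vector [q1, q2, w2, w3])"
  have col: "column 1 Q = q1" "column 2 Q = q2" "column 3 Q = w2" "column 4 Q = w3"
    by (simp_all add: Q_def column_def transpose_def vec_eq_iff vector_4)
  have QA: "transpose Q ** A ** Q = canonA \<epsilon> e2 e3"
    unfolding vec_eq_iff forall_4 congruence_entry col g_def[symmetric]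
    by (simp add: canonA_def vector_4 g11 g12 g21 g22 w2 w3 g_w2 g_w3 e2_def e3_def)
  have QB: "transpose Q ** B ** Q = canonB \<epsilon> e2 e3 r s"
    unfolding vec_eq_iff forall_4 congruence_entry col gM[symmetric] M_eqs
    by (simp add: canonB_def vector_4 g_lin g11 g12 g21 g22 w2 w3 g_w2 g_w3 e2_def e3_def)
  have e: "e2 \<in> {1, -1}" "e3 \<in> {1, -1}" using w2(3) w3(4) by (simp_all add: e2_def e3_def)
  show ?thesis
    unfolding canon_2_11_def
    using rs \<epsilon> e QA QB congruent_canonA_invertible[OF \<epsilon> e QA] by blast
qed

section \<open>Index sequences\<close>

lemma congruent_symmetric:
  fixes A Q :: "real^'n^'n"
  assumes Q: "invertible Q" and eq: "transpose Q ** A ** Q = D" and D: "transpose D = D"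
  shows "transpose A = A"
proof -
  obtain Q' where Q': "Q ** Q' = mat 1" using Q by (auto simp: invertible_def)
  have "transpose Q' ** D ** Q' = transpose (Q ** Q') ** A ** (Q ** Q')"
    unfolding eq[symmetric] by (simp only: matrix_transpose_mul matrix_mul_assoc)
  then have "transpose Q' ** D ** Q' = A" by (simp add: Q' transpose_mat)
  then show ?thesis
    using D by (metis matrix_transpose_mul matrix_mul_assoc transpose_transpose)
qed

lemma transpose_canonA: "transpose (canonA \<epsilon> e2 e3) = canonA \<epsilon> e2 e3"
  by (simp add: canonA_def transpose_def vec_eq_iff forall_4 vector_4)

lemma transpose_canonB: "transpose (canonB \<epsilon> e2 e3 r s) = canonB \<epsilon> e2 e3 r s"
  by (simp add: canonB_def transpose_def vec_eq_iff forall_4 vector_4)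

text \<open>The result of completing the square in the block of \<open>l A - B\<close> with rows (0,
  \<epsilon> (l - r)) and (\<epsilon> (l - r), -\<epsilon>).\<close>

definition canon_diag :: "real \<Rightarrow> real \<Rightarrow> real \<Rightarrow> real \<Rightarrow> real \<Rightarrow> real \<Rightarrow> 4 \<Rightarrow> real" where
  "canon_diag \<epsilon> e2 e3 r s l = ($) (vector [\<epsilon> * (l - r)\<^sup>2, - \<epsilon>, e2 * (l - s), e3 * (l - s)])"

text \<open>With c = l - r this is the change of basis completing the square: the first basis vector
  is corrected by \<open>c\<close> times the second.\<close>

definition shear :: "real \<Rightarrow> real^4^4" where
  "shear c = vector [vector [1, 0, 0, 0], vector [c, 1, 0, 0], vector [0, 0, 1, 0], vector [0, 0, 0, 1]]"

lemma shear_diagonalizes: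
  "transpose (shear (l - r)) ** (l *\<^sub>R canonA \<epsilon> e2 e3 - canonB \<epsilon> e2 e3 r s) ** shear (l - r)
    = diag_mat (canon_diag \<epsilon> e2 e3 r s l)"
  by (simp add: vec_eq_iff forall_4 matrix_matrix_mult_def sum_4 transpose_def shear_def canonA_def
      canonB_def diag_mat_def canon_diag_def vector_4 power2_eq_square algebra_simps)

lemma invertible_shear: "invertible (shear c)"
proof -
  have "shear (- c) ** shear c = mat 1" "shear c ** shear (- c) = mat 1"
    by (simp_all add: vec_eq_iff forall_4 matrix_matrix_mult_def sum_4 shear_def vector_4 mat_def)
  then show ?thesis unfolding invertible_def by blast
qed

lemma canon_pencil_diagonalizable:
  assumes "canon_2_11 A B r s \<epsilon> e2 e3"
  obtains R where "invertible R"
    "transpose R ** (l *\<^sub>R A - B) ** R = diag_mat (canon_diag \<epsilon> e2 e3 r s l)"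
proof -
  obtain Q where Q: "invertible Q" "transpose Q ** A ** Q = canonA \<epsilon> e2 e3"
    "transpose Q ** B ** Q = canonB \<epsilon> e2 e3 r s"
    using assms unfolding canon_2_11_def by blast
  let ?R = "Q ** shear (l - r)"
  have "transpose ?R ** (l *\<^sub>R A - B) ** ?R
      = transpose (shear (l - r)) ** (transpose Q ** (l *\<^sub>R A - B) ** Q) ** shear (l - r)"
    by (simp only: matrix_transpose_mul matrix_mul_assoc)
  also have "transpose Q ** (l *\<^sub>R A - B) ** Q = l *\<^sub>R canonA \<epsilon> e2 e3 - canonB \<epsilon> e2 e3 r s"
    by (simp only: congruence_pencil Q(2,3))
  also note shear_diagonalizes
  finally show ?thesis using that invertible_mult[OF Q(1) invertible_shear] by blast
qed

text \<open>\<open>index_seq\<close> speaks of arbitrary matrices; the symmetry required by the law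
  of inertia is recovered from the canonical form.\<close>

lemma canon_symmetric:
  assumes "canon_2_11 A B r s \<epsilon> e2 e3"
  shows "transpose A = A" "transpose B = B"
proof -
  obtain Q where Q: "invertible Q" "transpose Q ** A ** Q = canonA \<epsilon> e2 e3"
    "transpose Q ** B ** Q = canonB \<epsilon> e2 e3 r s"
    using assms unfolding canon_2_11_def by blast
  show "transpose A = A" "transpose B = B"
    using congruent_symmetric[OF Q(1,2) transpose_canonA]
      congruent_symmetric[OF Q(1,3) transpose_canonB] .
qed

lemma card_4: "card {i::4. P i} = of_bool (P 1) + of_bool (P 2) + of_bool (P 3) + of_bool (P 4)"
proof -
  have "card {i::4. P i} = (\<Sum>i\<in>UNIV. of_bool (P i))" by (simp add: of_bool_def sum.If_cases)
  then show ?thesis by (simp add: sum_4)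
qed

text \<open>For l \<noteq> r the first two diagonal entries have opposite signs whatever \<epsilon>
  is, so the count depends only on \<open>e2\<close>, \<open>e3\<close> and the side of
  \<open>s\<close> on which \<open>l\<close> lies.\<close>

lemma canon_Id:
  assumes canon: "canon_2_11 A B r s \<epsilon> e2 e3" and "l \<noteq> r"
  shows "Id A B l = 1 + of_bool (e2 * (l - s) > 0) + of_bool (e3 * (l - s) > 0)"
proof -
  have "transpose (l *\<^sub>R A - B) = l *\<^sub>R A - B"
    using canon_symmetric[OF canon] by (simp add: transpose_def vec_eq_iff)
  then have "Id A B l = card {i. canon_diag \<epsilon> e2 e3 r s l i > 0}"
    unfolding Id_def using canon_pencil_diagonalizable[OF canon] num_pos_eig_congruent_diag by metis
  moreover have "\<epsilon> \<in> {1, -1}" using canon by (simp add: canon_2_11_def)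
  ultimately show ?thesis
    using \<open>l \<noteq> r\<close> by (auto simp: card_4 canon_diag_def vector_4)
qed

text \<open>Congruence multiplies the determinant by the nonzero square of \<open>det R\<close>, so
  the roots can be read off the diagonal.\<close>

lemma canon_pencil_poly_roots:
  assumes canon: "canon_2_11 A B r s \<epsilon> e2 e3"
  shows "{l. poly (pencil_poly A B) l = 0} = {r, s}"
proof -
  have "poly (pencil_poly A B) l = 0 \<longleftrightarrow> l \<in> {r, s}" for l
  proof -
    obtain R where R: "invertible R"
      "transpose R ** (l *\<^sub>R A - B) ** R = diag_mat (canon_diag \<epsilon> e2 e3 r s l)"
      using canon_pencil_diagonalizable[OF canon] .
    have "det (diag_mat (canon_diag \<epsilon> e2 e3 r s l)) = (\<Prod>i\<in>UNIV. canon_diag \<epsilon> e2 e3 r s l i)"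
      by (subst det_diagonal) (auto simp: diag_mat_def)
    then have eq: "det R * det R * det (l *\<^sub>R A - B) = (\<Prod>i\<in>UNIV. canon_diag \<epsilon> e2 e3 r s l i)"
      unfolding R(2)[symmetric] by (simp add: det_mul mult_ac)
    then have "det (l *\<^sub>R A - B) = 0 \<longleftrightarrow> (\<exists>i. canon_diag \<epsilon> e2 e3 r s l i = 0)"
    proof -
      have "det R \<noteq> 0" using R(1) by (simp add: invertible_det_nz)
      then have "det (l *\<^sub>R A - B) = 0 \<longleftrightarrow> (\<Prod>i\<in>UNIV. canon_diag \<epsilon> e2 e3 r s l i) = 0"
        using eq by (metis mult_eq_0_iff)
      then show ?thesis by simp
    qed
    moreover have "\<epsilon> \<noteq> 0" "e2 \<noteq> 0" "e3 \<noteq> 0" using canon by (auto simp: canon_2_11_def)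
    moreover have "(\<exists>i::4. P i) \<longleftrightarrow> P 1 \<or> P 2 \<or> P 3 \<or> P 4" for P
      by (metis exhaust_4)
    ultimately show ?thesis
      by (auto simp: poly_pencil_poly canon_diag_def vector_4)
  qed
  then show ?thesis by blast
qed

lemma canon_det_nz:
  assumes "canon_2_11 A B r s \<epsilon> e2 e3"
  shows "det A \<noteq> 0"
proof
  assume "det A = 0"
  obtain Q where "transpose Q ** A ** Q = canonA \<epsilon> e2 e3"
    using assms unfolding canon_2_11_def by blast
  then have "det (canonA \<epsilon> e2 e3) = 0" using \<open>det A = 0\<close> by (metis det_mul mult_zero_left mult_zero_right)
  moreover have "det (canonA \<epsilon> e2 e3 ** canonA \<epsilon> e2 e3) = 1"
    using assms by (simp add: canon_2_11_def canonA_involution)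
  ultimately show False by (simp add: det_mul)
qed

text \<open>Left of \<open>s\<close>, on both sides of \<open>r\<close>, the 1x1 blocks of sign -1
  contribute to \<open>Id\<close>; right of \<open>s\<close> those of sign +1 do, and there are 2 -
  (k - 1) of them, whence the last entry 4 - k.\<close>

lemma canon_index_seq:
  assumes canon: "canon_2_11 A B r s (of_int \<epsilon>) e2 e3" and "r < s"
  defines "k \<equiv> 1 + of_bool (e2 = -1) + of_bool (e3 = -1)"
  shows "index_seq A B k [Wr \<epsilon>, Wr \<epsilon>] k [Bar, Bar] (4 - k)"
proof -
  have e: "e2 \<in> {1, -1}" "e3 \<in> {1, -1}" using canon by (auto simp: canon_2_11_def)
  have "Id A B l = k" if "l \<noteq> r" "l < s" for l
    unfolding canon_Id[OF canon that(1)] k_def using e that(2) by (auto simp: zero_less_mult_iff)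
  moreover have "Id A B l = 4 - k" if "s < l" for l
  proof -
    have "l \<noteq> r" using that \<open>r < s\<close> by simp
    then show ?thesis
      unfolding canon_Id[OF canon \<open>l \<noteq> r\<close>] k_def using e that by (auto simp: zero_less_mult_iff)
  qed
  moreover have "root_blocks A B r [Wr \<epsilon>, Wr \<epsilon>]" "root_blocks A B s [Bar, Bar]"
    using canon unfolding root_blocks_def by blast+
  ultimately show ?thesis
    unfolding index_seq_def
    using canon_det_nz[OF canon] canon_pencil_poly_roots[OF canon] \<open>r < s\<close>
    by (intro conjI exI[of _ r] exI[of _ s]) auto
qed

text \<open>The subscript of the sequence comes with a canonical form, and the last entry counts its
  1x1 blocks of sign +1.\<close>

lemma index_seq_imp_canon:
  assumes "index_seq A B s0 [Wr \<epsilon>, Wr \<epsilon>] s1 [Bar, Bar] s2"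
  obtains r s e2 e3 where "r < s" "canon_2_11 A B r s (of_int \<epsilon>) e2 e3"
    "s2 = 1 + of_bool (e2 = 1) + of_bool (e3 = 1)"
proof -
  obtain r s where rs: "r < s" "{l. poly (pencil_poly A B) l = 0} = {r, s}"
    and s2: "\<And>l. s < l \<Longrightarrow> Id A B l = s2" and blocks: "root_blocks A B r [Wr \<epsilon>, Wr \<epsilon>]"
    using assms unfolding index_seq_def by blast
  obtain s' e2 e3 where canon: "canon_2_11 A B r s' (of_int \<epsilon>) e2 e3"
    using blocks by (auto simp: root_blocks_def)
  have "r \<noteq> s'" using canon by (simp add: canon_2_11_def)
  \<comment> \<open>The canonical form brings its own second root; the root sets {r, s'} and {r, s}
    are compared.\<close>
  then have "s' = s" using canon_pencil_poly_roots[OF canon] rs by auto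
  have e: "e2 \<in> {1, -1}" "e3 \<in> {1, -1}" using canon by (auto simp: canon_2_11_def)
  have "s2 = 1 + of_bool (e2 = 1) + of_bool (e3 = 1)"
    using s2[of "s + 1"] canon_Id[OF canon, of "s + 1"] e rs(1) \<open>s' = s\<close> by auto
  then show ?thesis using that rs(1) canon \<open>s' = s\<close> by blast
qed

section \<open>Complement and reversal of the pencil, and the three sequences\<close>

lemma congruence_uminus:
  fixes A Q :: "real^'n^'n"
  shows "transpose Q ** (- A) ** Q = - (transpose Q ** A ** Q)"
  by (simp add: vec_eq_iff matrix_matrix_mult_def sum_negf)

text \<open>Negating both matrices leaves the eigenvalues of the pencil in place and flips the sign
  of every block.\<close>

lemma canon_negate:
  assumes "canon_2_11 A B r s \<epsilon> e2 e3"
  shows "canon_2_11 (- A) (- B) r s (- \<epsilon>) (- e2) (- e3)"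
proof -
  have "- canonA \<epsilon> e2 e3 = canonA (- \<epsilon>) (- e2) (- e3)"
    "- canonB \<epsilon> e2 e3 r s = canonB (- \<epsilon>) (- e2) (- e3) r s"
    by (simp_all add: vec_eq_iff forall_4 canonA_def canonB_def vector_4)
  then show ?thesis
    using assms unfolding canon_2_11_def congruence_uminus by auto
qed

text \<open>Passing to - B turns the Jordan block of \<open>r\<close> into one with -1 above the
  diagonal. The reflection \<open>D\<close> in the second coordinate restores the 1, at the price of
  flipping \<epsilon>.\<close>

lemma canon_reflect:
  assumes "canon_2_11 A B r s \<epsilon> e2 e3"
  shows "canon_2_11 A (- B) (- r) (- s) (- \<epsilon>) e2 e3"
proof -
  obtain Q where Q: "invertible Q" "transpose Q ** A ** Q = canonA \<epsilon> e2 e3"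
    "transpose Q ** B ** Q = canonB \<epsilon> e2 e3 r s"
    using assms unfolding canon_2_11_def by blast
  define D :: "real^4^4" where "D = diag_mat (($) (vector [1, -1, 1, 1]))"
  have DD: "D ** D = mat 1"
    by (simp add: D_def diag_mat_def vec_eq_iff forall_4 matrix_matrix_mult_def sum_4 vector_4 mat_def)
  have D: "transpose D ** canonA \<epsilon> e2 e3 ** D = canonA (- \<epsilon>) e2 e3"
    "- (transpose D ** canonB \<epsilon> e2 e3 r s ** D) = canonB (- \<epsilon>) e2 e3 (- r) (- s)"
    by (simp_all add: D_def diag_mat_def vec_eq_iff forall_4 matrix_matrix_mult_def sum_4
        transpose_def canonA_def canonB_def vector_4)
  have QD: "transpose (Q ** D) ** X ** (Q ** D) = transpose D ** (transpose Q ** X ** Q) ** D" for X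
    by (simp only: matrix_transpose_mul matrix_mul_assoc)
  have "invertible D" using DD by (auto simp: invertible_def)
  moreover have "transpose (Q ** D) ** A ** (Q ** D) = canonA (- \<epsilon>) e2 e3"
    "transpose (Q ** D) ** (- B) ** (Q ** D) = canonB (- \<epsilon>) e2 e3 (- r) (- s)"
    unfolding QD congruence_uminus Q D by simp_all
  ultimately show ?thesis
    using assms Q(1) invertible_mult[of Q D] unfolding canon_2_11_def by auto
qed

lemma canon_index_seq_cases:
  assumes canon: "canon_2_11 A B r s \<epsilon> e2 e3" and "r < s"
  shows "\<exists>\<delta> \<in> {1, -1}.
    index_seq (\<delta> *\<^sub>R A) (\<delta> *\<^sub>R B) 2 [Wr (-1), Wr (-1)] 2 [Bar, Bar] 2 \<or>
    index_seq (\<delta> *\<^sub>R A) (\<delta> *\<^sub>R B) 1 [Wr 1, Wr 1] 1 [Bar, Bar] 3 \<or>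
    index_seq (\<delta> *\<^sub>R A) (\<delta> *\<^sub>R B) 1 [Wr (-1), Wr (-1)] 1 [Bar, Bar] 3"
proof -
  have signs: "\<epsilon> \<in> {1, -1}" "e2 \<in> {1, -1}" "e3 \<in> {1, -1}"
    using canon by (auto simp: canon_2_11_def)
  obtain \<eta> :: int where \<eta>: "\<epsilon> = of_int \<eta>" "\<eta> \<in> {1, -1}"
    using signs(1) by (metis insert_iff of_int_1 of_int_minus singletonD)
  note pos = canon_index_seq[OF canon[unfolded \<eta>(1)] \<open>r < s\<close>]
  have "canon_2_11 (- A) (- B) r s (of_int (- \<eta>)) (- e2) (- e3)"
    using canon_negate[OF canon] \<eta>(1) by simp
  note neg = canon_index_seq[OF this \<open>r < s\<close>]
  consider "e2 \<noteq> e3" "\<eta> = 1" | "e2 \<noteq> e3" "\<eta> = -1" | "e2 = 1" "e3 = 1" | "e2 = -1" "e3 = -1"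
    using signs \<eta>(2) by auto
  then show ?thesis
  proof cases
    case 1
    then show ?thesis using neg signs by (intro bexI[of _ "-1"]) (auto simp: numeral_2_eq_2)
  next
    case 2
    then show ?thesis using pos signs by (intro bexI[of _ 1]) (auto simp: numeral_2_eq_2)
  next
    case 3
    then show ?thesis using pos \<eta>(2) by (intro bexI[of _ 1]) (auto simp: numeral_2_eq_2)
  next
    case 4
    then show ?thesis using neg \<eta>(2) by (intro bexI[of _ "-1"]) (auto simp: numeral_2_eq_2)
  qed
qed

theorem canon_index_seq_equiv:
  assumes canon: "canon_2_11 A B r s \<epsilon> e2 e3"
  shows "index_seq_equiv A B 2 [Wr (-1), Wr (-1)] 2 [Bar, Bar] 2 \<or>
    index_seq_equiv A B 1 [Wr 1, Wr 1] 1 [Bar, Bar] 3 \<or>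
    index_seq_equiv A B 1 [Wr (-1), Wr (-1)] 1 [Bar, Bar] 3"
proof -
  \<comment> \<open>All three sequences begin with the 2x2 block, so its root has to be the smaller
    one; otherwise \<rho> = -1 reverses the order.\<close>
  have "\<exists>\<rho> \<in> {1, -1}. \<exists>r s \<epsilon>. r < s \<and> canon_2_11 A (\<rho> *\<^sub>R B) r s \<epsilon> e2 e3"
  proof (cases "r < s")
    case True
    then show ?thesis using canon by (intro bexI[of _ 1]) auto
  next
    case False
    then have "- r < - s" using canon by (auto simp: canon_2_11_def)
    moreover have "canon_2_11 A (-1 *\<^sub>R B) (- r) (- s) (- \<epsilon>) e2 e3"
      using canon_reflect[OF canon] by simp
    ultimately show ?thesis by blast
  qed
  then obtain \<rho> r s \<epsilon> where \<rho>: "\<rho> \<in> {1, -1}" and "r < s"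
    and canon': "canon_2_11 A (\<rho> *\<^sub>R B) r s \<epsilon> e2 e3"
    by blast
  then obtain \<delta> where \<delta>: "\<delta> \<in> {1, -1}" and idx:
    "index_seq (\<delta> *\<^sub>R A) (\<delta> *\<^sub>R \<rho> *\<^sub>R B) 2 [Wr (-1), Wr (-1)] 2 [Bar, Bar] 2 \<or>
    index_seq (\<delta> *\<^sub>R A) (\<delta> *\<^sub>R \<rho> *\<^sub>R B) 1 [Wr 1, Wr 1] 1 [Bar, Bar] 3 \<or>
    index_seq (\<delta> *\<^sub>R A) (\<delta> *\<^sub>R \<rho> *\<^sub>R B) 1 [Wr (-1), Wr (-1)] 1 [Bar, Bar] 3"
    using canon_index_seq_cases[OF canon' \<open>r < s\<close>] by (elim bexE)
  have "pencil_basis_change A B (\<delta> *\<^sub>R A) (\<delta> *\<^sub>R \<rho> *\<^sub>R B)"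
    unfolding pencil_basis_change_def using \<rho> \<delta>
    by (intro exI[of _ \<delta>] exI[of _ 0] exI[of _ "\<delta> * \<rho>"]) auto
  then show ?thesis using idx unfolding index_seq_equiv_def by blast
qed

section \<open>The intersection curve in canonical coordinates\<close>

text \<open>The action of a real matrix on complex points. Being real, it commutes with conjugation
  and keeps real points real.\<close>

definition cmap :: "real^4^4 \<Rightarrow> complex^4 \<Rightarrow> complex^4" where
  "cmap Q u = map_matrix complex_of_real Q *v u"

lemma cmap_linear:
  "cmap Q (u + v) = cmap Q u + cmap Q v" "cmap Q (c *s u) = c *s cmap Q u" "cmap Q 0 = 0"
  by (simp_all add: cmap_def matrix_vector_right_distrib vector_scalar_commute)

lemma cmap_cv: "cmap Q (cv Y) = cv (Q *v Y)"
  unfolding cmap_def by (rule map_matrix_of_real_mult_cv)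

lemma cconj_cmap: "cconj (cmap Q u) = cmap Q (cconj u)"
  by (simp add: cconj_def cmap_def vec_eq_iff matrix_vector_mult_def map_matrix_def)

lemma cmap_cmap: "cmap Q (cmap R u) = cmap (Q ** R) u"
  by (simp add: cmap_def matrix_vector_mul_assoc map_matrix_of_real_mult)

lemma cmap_mat_1: "cmap (mat 1) u = u"
proof -
  have "map_matrix complex_of_real (mat 1) = (mat 1 :: complex^4^4)"
    by (simp add: vec_eq_iff map_matrix_def mat_def)
  then show ?thesis by (simp add: cmap_def)
qed

lemma qf_eq_sum: "qf M X = (\<Sum>i\<in>UNIV. X $ i * cmap M X $ i)"
  by (simp add: qf_def cmap_def matrix_vector_mult_def map_matrix_def sum_distrib_left mult_ac)

lemma sum_matrix_vector_transpose:
  fixes N :: "'a::comm_semiring_1^'n^'m"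
  shows "(\<Sum>i\<in>UNIV. (N *v u) $ i * y $ i) = (\<Sum>j\<in>UNIV. u $ j * (transpose N *v y) $ j)"
  by (simp add: matrix_vector_mult_def transpose_def sum_distrib_left sum_distrib_right mult_ac)
    (rule sum.swap)

lemma qf_cmap: "qf M (cmap Q u) = qf (transpose Q ** M ** Q) u"
proof -
  have "transpose (map_matrix complex_of_real Q) = map_matrix complex_of_real (transpose Q)"
    by (simp add: vec_eq_iff map_matrix_def transpose_def)
  then show ?thesis
    unfolding qf_eq_sum cmap_def sum_matrix_vector_transpose
    by (simp add: map_matrix_of_real_mult matrix_vector_mul_assoc matrix_mul_assoc)
qed

lemma qsic_pencil_basis_change:
  assumes "pencil_basis_change A B A' B'"
  shows "qsic A' B' = qsic A B"
proof -
  obtain a b c d where d: "a * d - b * c \<noteq> 0"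
    and A': "A' = a *\<^sub>R A + b *\<^sub>R B" and B': "B' = c *\<^sub>R A + d *\<^sub>R B"
    using assms unfolding pencil_basis_change_def by blast
  have qf_comb: "qf (x *\<^sub>R A + y *\<^sub>R B) X = of_real x * qf A X + of_real y * qf B X" for x y X
    by (simp add: qf_def sum_distrib_left sum.distrib algebra_simps)
  have dC: "complex_of_real a * of_real d - of_real b * of_real c \<noteq> 0"
    using d by (metis of_real_diff of_real_eq_0_iff of_real_mult)
  have "qf A' X = 0 \<and> qf B' X = 0 \<longleftrightarrow> qf A X = 0 \<and> qf B X = 0" for X
  proof
    assume "qf A' X = 0 \<and> qf B' X = 0"
    then have eq: "of_real a * qf A X + of_real b * qf B X = 0"
      "of_real c * qf A X + of_real d * qf B X = 0"
      by (simp_all add: A' B' qf_comb)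
    \<comment> \<open>Cramer's rule for the two equations in \<open>eq\<close>.\<close>
    have "(of_real a * of_real d - of_real b * of_real c) * qf A X
        = of_real d * (of_real a * qf A X + of_real b * qf B X)
          - of_real b * (of_real c * qf A X + of_real d * qf B X)"
      "(of_real a * of_real d - of_real b * of_real c) * qf B X
        = of_real a * (of_real c * qf A X + of_real d * qf B X)
          - of_real c * (of_real a * qf A X + of_real b * qf B X)"
      by (simp_all add: algebra_simps)
    then show "qf A X = 0 \<and> qf B X = 0" unfolding eq using dC by simp
  qed (simp add: A' B' qf_comb)
  then show ?thesis unfolding qsic_def by blast
qed

section \<open>Invariance of the geometric notions under real projective transformations\<close>

locale projectivity =
  fixes Q Q' :: "real^4^4"
  assumes QQ': "Q ** Q' = mat 1" and Q'Q: "Q' ** Q = mat 1"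
begin

lemma cmap_left_inverse: "cmap Q' (cmap Q u) = u"
  and cmap_right_inverse: "cmap Q (cmap Q' u) = u"
  by (simp_all add: cmap_cmap QQ' Q'Q cmap_mat_1)

lemma inj_cmap: "inj (cmap Q)"
  by (metis injI cmap_left_inverse)

lemma cmap_eq_0: "cmap Q u = 0 \<longleftrightarrow> u = 0"
  using inj_cmap cmap_linear(3) by (metis injD)

lemma mem_cmap_image: "X \<in> cmap Q ` S \<longleftrightarrow> cmap Q' X \<in> S"
  by (metis cmap_left_inverse cmap_right_inverse image_iff)

lemma matrix_eq_0: "Q *v Y = 0 \<longleftrightarrow> Y = 0" "Q' *v Y = 0 \<longleftrightarrow> Y = 0"
  by (metis QQ' Q'Q matrix_vector_mul_assoc matrix_vector_mul_lid matrix_vector_mult_0_right)+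

lemma qsic_cmap: "qsic A B = cmap Q ` qsic (transpose Q ** A ** Q) (transpose Q ** B ** Q)"
proof -
  have eq0: "cmap Q' X = 0 \<longleftrightarrow> X = 0" for X by (metis cmap_right_inverse cmap_linear(3))
  show ?thesis
    unfolding set_eq_iff mem_cmap_image qsic_def mem_Collect_eq
    unfolding qf_cmap[symmetric] cmap_right_inverse eq0 by blast
qed

lemma line_through_cmap: "line_through (cmap Q P) (cmap Q R) = cmap Q ` line_through P R"
proof -
  have "line_through (cmap Q P) (cmap Q R) = {X. X \<noteq> 0 \<and> (\<exists>a b. X = cmap Q (a *s P + b *s R))}"
    by (simp add: line_through_def cmap_linear)
  also have "\<dots> = cmap Q ` line_through P R"
    unfolding line_through_def by (auto simp: cmap_eq_0 intro!: imageI)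
  finally show ?thesis .
qed

lemma cindep2_cmap: "cindep2 P R \<Longrightarrow> cindep2 (cmap Q P) (cmap Q R)"
  unfolding cindep2_def cmap_linear[symmetric] cmap_eq_0 .

lemma cindep3_cmap: "cindep3 P R S \<Longrightarrow> cindep3 (cmap Q P) (cmap Q R) (cmap Q S)"
  unfolding cindep3_def cmap_linear[symmetric] cmap_eq_0 .

lemma is_line_cmap: "is_line L \<Longrightarrow> is_line (cmap Q ` L)"
  unfolding is_line_def using cindep2_cmap line_through_cmap[symmetric] by blast

lemma is_real_line_cmap: "is_real_line L \<Longrightarrow> is_real_line (cmap Q ` L)"
  unfolding is_real_line_def using cindep2_cmap line_through_cmap[symmetric]
  by (elim exE conjE) (metis cmap_cv)

lemma conj_lines_cmap: "conj_lines L1 L2 \<Longrightarrow> conj_lines (cmap Q ` L1) (cmap Q ` L2)"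
proof -
  assume L: "conj_lines L1 L2"
  have "cmap Q ` cconj ` L1 = cconj ` cmap Q ` L1" by (simp only: image_image cconj_cmap)
  then show ?thesis
    using L inj_image_eq_iff[OF inj_cmap, of L1 L2] is_line_cmap unfolding conj_lines_def by metis
qed

lemma is_conic_cmap:
  assumes "is_conic C"
  shows "is_conic (cmap Q ` C)"
proof -
  obtain P0 P1 P2 M where ind: "cindep3 P0 P1 P2" and M: "transpose M = M" "det M \<noteq> 0"
    and C: "C = {X. X \<noteq> 0 \<and> (\<exists>t :: complex^3. X = t$1 *s P0 + t$2 *s P1 + t$3 *s P2 \<and>
                          (\<Sum>i\<in>UNIV. \<Sum>j\<in>UNIV. M$i$j * t$i * t$j) = 0)}"
    using assms unfolding is_conic_def by blast
  have "cmap Q ` C = {X. X \<noteq> 0 \<and> (\<exists>t :: complex^3.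
      X = cmap Q (t$1 *s P0 + t$2 *s P1 + t$3 *s P2) \<and>
      (\<Sum>i\<in>UNIV. \<Sum>j\<in>UNIV. M$i$j * t$i * t$j) = 0)}"
    unfolding C by (auto simp: cmap_eq_0)
  then show ?thesis
    unfolding is_conic_def cmap_linear using cindep3_cmap[OF ind] M by blast
qed

lemma cv_mem_cmap_image: "cv Y \<in> cmap Q ` S \<longleftrightarrow> cv (Q' *v Y) \<in> S"
  by (simp add: mem_cmap_image cmap_cv)

text \<open>The matrix acts on one-dimensional subspaces by taking images, and this action is
  injective.\<close>

lemma infinite_real_points_cmap:
  assumes "infinite (real_points S)"
  shows "infinite (real_points (cmap Q ` S))"
proof -
  have "(`) ((*v) Q) ` real_points S \<subseteq> real_points (cmap Q ` S)"
  proof clarify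
    fix V assume "V \<in> real_points S"
    then obtain Y where Y: "V = span {Y}" "Y \<noteq> 0" "cv Y \<in> S" unfolding real_points_def by blast
    have "(*v) Q ` V = span {Q *v Y}"
      using linear_span_image[OF matrix_vector_mul_linear, of Q "{Y}"] by (simp add: Y)
    moreover have "Q *v Y \<noteq> 0" using Y(2) matrix_eq_0 by simp
    moreover have "cv (Q *v Y) \<in> cmap Q ` S" using Y(3) by (simp add: cmap_cv[symmetric])
    ultimately show "(*v) Q ` V \<in> real_points (cmap Q ` S)" unfolding real_points_def by blast
  qed
  moreover have "inj ((`) ((*v) Q))"
  proof (rule injI)
    fix V W assume "(*v) Q ` V = (*v) Q ` W"
    moreover have "inj ((*v) Q)" using QQ' Q'Q by (intro inj_matrix_vector_mult) (auto simp: invertible_def)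
    ultimately show "V = W" by (simp add: inj_image_eq_iff)
  qed
  ultimately show ?thesis
    using assms by (meson finite_imageD finite_subset inj_on_subset subset_UNIV)
qed

lemma real_conic_cmap: "real_conic C \<Longrightarrow> real_conic (cmap Q ` C)"
  unfolding real_conic_def by (simp add: is_conic_cmap infinite_real_points_cmap)

lemma ppoint_cmap: "ppoint (Q *v Y) = cmap Q ` ppoint Y"
proof -
  have "ppoint (Q *v Y) = {X. X \<noteq> 0 \<and> (\<exists>c. X = cmap Q (c *s cv Y))}"
    by (simp add: ppoint_def cmap_linear cmap_cv)
  also have "\<dots> = cmap Q ` ppoint Y" unfolding ppoint_def by (auto simp: cmap_eq_0)
  finally show ?thesis .
qed

end

section \<open>The conic and the lines of the canonical pencil\<close>

definition canon_conic :: "real \<Rightarrow> real \<Rightarrow> real \<Rightarrow> real \<Rightarrow> (complex^4) set" where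
  "canon_conic \<epsilon> e2 e3 d = {u. u \<noteq> 0 \<and> u $ 2 = of_real d * u $ 1 \<and>
    of_real (2 * \<epsilon> * d) * (u $ 1)\<^sup>2 + of_real e2 * (u $ 3)\<^sup>2 + of_real e3 * (u $ 4)\<^sup>2 = 0}"

text \<open>In the plane u2 = 0 the quadric of \<open>canonA\<close> reads e2 u3^2 + e3 u4^2 = 0, a
  pair of lines with parameters k and -k where e2 + e3 k^2 = 0: k = 1 for opposite signs, k = \<i>
  for equal ones.\<close>

definition canon_line :: "complex \<Rightarrow> (complex^4) set" where
  "canon_line k = {u. u \<noteq> 0 \<and> u $ 2 = 0 \<and> u $ 4 = k * u $ 3}"

lemma qf_canonA:
  "qf (canonA \<epsilon> e2 e3) u
    = 2 * of_real \<epsilon> * u $ 1 * u $ 2 + of_real e2 * (u $ 3)\<^sup>2 + of_real e3 * (u $ 4)\<^sup>2"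
  by (simp add: qf_def sum_4 canonA_def vector_4 power2_eq_square algebra_simps)

lemma qf_canonB:
  "qf (canonB \<epsilon> e2 e3 r s) u = 2 * of_real (\<epsilon> * r) * u $ 1 * u $ 2 + of_real \<epsilon> * (u $ 2)\<^sup>2
    + of_real s * (of_real e2 * (u $ 3)\<^sup>2 + of_real e3 * (u $ 4)\<^sup>2)"
  by (simp add: qf_def sum_4 canonB_def vector_4 power2_eq_square algebra_simps)

text \<open>The member \<open>B - s A\<close> of the pencil splits into the two planes \<open>u\<^sub>2 = 0\<close> and
  \<open>u\<^sub>2 = 2 (s - r) u\<^sub>1\<close>: the first one cuts out the lines and the second one the conic.\<close>
lemma qsic_canon:
  assumes "\<epsilon> \<noteq> 0" "e3 \<noteq> 0" and k: "of_real e2 + of_real e3 * k\<^sup>2 = 0"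
  shows "qsic (canonA \<epsilon> e2 e3) (canonB \<epsilon> e2 e3 r s)
    = canon_conic \<epsilon> e2 e3 (2 * (s - r)) \<union> canon_line k \<union> canon_line (- k)"
proof -
  let ?d = "complex_of_real (2 * (s - r))"
  have "qf (canonA \<epsilon> e2 e3) u = 0 \<and> qf (canonB \<epsilon> e2 e3 r s) u = 0 \<longleftrightarrow>
      (u $ 2 = ?d * u $ 1 \<and>
        of_real (2 * \<epsilon> * (2 * (s - r))) * (u $ 1)\<^sup>2 + of_real e2 * (u $ 3)\<^sup>2 + of_real e3 * (u $ 4)\<^sup>2 = 0) \<or>
      u $ 2 = 0 \<and> (u $ 4 = k * u $ 3 \<or> u $ 4 = - k * u $ 3)" for u
  proof -
    have "qf (canonB \<epsilon> e2 e3 r s) u - of_real s * qf (canonA \<epsilon> e2 e3) u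
        = of_real \<epsilon> * (u $ 2 * (u $ 2 - ?d * u $ 1))"
      unfolding qf_canonA qf_canonB by (simp add: power2_eq_square algebra_simps)
    then have "qf (canonA \<epsilon> e2 e3) u = 0 \<and> qf (canonB \<epsilon> e2 e3 r s) u = 0 \<longleftrightarrow>
        qf (canonA \<epsilon> e2 e3) u = 0 \<and> (u $ 2 = 0 \<or> u $ 2 = ?d * u $ 1)"
      using assms(1) by auto
    also have "\<dots> \<longleftrightarrow> u $ 2 = ?d * u $ 1 \<and> qf (canonA \<epsilon> e2 e3) u = 0 \<or>
        u $ 2 = 0 \<and> qf (canonA \<epsilon> e2 e3) u = 0" by blast
    also have "u $ 2 = ?d * u $ 1 \<and> qf (canonA \<epsilon> e2 e3) u = 0 \<longleftrightarrow> u $ 2 = ?d * u $ 1 \<and>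
        of_real (2 * \<epsilon> * (2 * (s - r))) * (u $ 1)\<^sup>2 + of_real e2 * (u $ 3)\<^sup>2 + of_real e3 * (u $ 4)\<^sup>2 = 0"
      unfolding qf_canonA by (rule conj_cong) (simp_all add: power2_eq_square mult_ac)
    also have "u $ 2 = 0 \<and> qf (canonA \<epsilon> e2 e3) u = 0 \<longleftrightarrow>
        u $ 2 = 0 \<and> (u $ 4 = k * u $ 3 \<or> u $ 4 = - k * u $ 3)"
    proof (rule conj_cong[OF refl])
      assume "u $ 2 = 0"
      then have "qf (canonA \<epsilon> e2 e3) u = of_real e2 * (u $ 3)\<^sup>2 + of_real e3 * (u $ 4)\<^sup>2"
        by (simp add: qf_canonA)
      \<comment> \<open>The equation for \<open>k\<close> eliminates \<open>e2\<close> and leaves a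
        difference of squares.\<close>
      also have "of_real e2 = - (of_real e3 * k\<^sup>2)" using k by (simp add: eq_neg_iff_add_eq_0)
      also have "- (of_real e3 * k\<^sup>2) * (u $ 3)\<^sup>2 + of_real e3 * (u $ 4)\<^sup>2
          = of_real e3 * ((u $ 4 - k * u $ 3) * (u $ 4 + k * u $ 3))"
        by (simp add: power2_eq_square algebra_simps)
      finally show "qf (canonA \<epsilon> e2 e3) u = 0 \<longleftrightarrow> u $ 4 = k * u $ 3 \<or> u $ 4 = - k * u $ 3"
        using assms(2) by (simp add: eq_neg_iff_add_eq_0)
    qed
    finally show ?thesis .
  qed
  then show ?thesis
    unfolding qsic_def canon_conic_def canon_line_def by blast
qed

lemma canon_line_eq_line_through:
  "canon_line k = line_through (vector [1, 0, 0, 0]) (vector [0, 0, 1, k])"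
proof -
  have "u $ 2 = 0 \<and> u $ 4 = k * u $ 3 \<longleftrightarrow>
      (\<exists>a b. u = a *s vector [1, 0, 0, 0] + b *s vector [0, 0, 1, k])" for u :: "complex^4"
    by (auto simp: vec_eq_iff forall_4 vector_4 intro!: exI[of _ "u $ 1"] exI[of _ "u $ 3"])
  then show ?thesis unfolding canon_line_def line_through_def by simp
qed

lemma cindep2_canon_line: "cindep2 (vector [1, 0, 0, 0]) (vector [0, 0, 1, k])"
  by (auto simp: cindep2_def vec_eq_iff forall_4 vector_4)

lemma is_real_line_canon_line: "is_real_line (canon_line (of_real k))"
proof -
  have "cv (vector [1, 0, 0, 0]) = vector [1, 0, 0, 0]"
    "cv (vector [0, 0, 1, k]) = vector [0, 0, 1, of_real k]"
    by (simp_all add: cv_def vec_eq_iff forall_4 vector_4)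
  then show ?thesis
    unfolding is_real_line_def canon_line_eq_line_through using cindep2_canon_line by metis
qed

lemma canon_line_inject: "canon_line k = canon_line l \<longleftrightarrow> k = l"
proof
  assume "canon_line k = canon_line l"
  moreover have "vector [0, 0, 1, k] \<in> canon_line k"
    by (auto simp: canon_line_def vec_eq_iff forall_4 vector_4)
  ultimately show "k = l" by (simp add: canon_line_def vector_4)
qed simp

lemma conj_lines_canon_line: "conj_lines (canon_line \<i>) (canon_line (- \<i>))"
proof -
  have cconj: "cconj (cconj u) = u" "cconj u = 0 \<longleftrightarrow> u = 0" for u
    by (simp_all add: cconj_def vec_eq_iff)
  have mem: "cconj u \<in> canon_line (- \<i>) \<longleftrightarrow> u \<in> canon_line \<i>" for u
  proof -
    have "cnj (u $ 4) = - \<i> * cnj (u $ 3) \<longleftrightarrow> u $ 4 = \<i> * u $ 3"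
      by (metis complex_cnj_cancel_iff complex_cnj_mult complex_cnj_i)
    then show ?thesis by (simp add: canon_line_def cconj) (simp add: cconj_def)
  qed
  then have "canon_line (- \<i>) = cconj ` canon_line \<i>"
    by (metis cconj(1) image_eqI subsetI subset_antisym image_subset_iff)
  moreover have "is_line (canon_line \<i>)"
    unfolding is_line_def canon_line_eq_line_through using cindep2_canon_line by blast
  ultimately show ?thesis
    unfolding conj_lines_def canon_line_inject by (simp add: complex_eq_iff)
qed

text \<open>The coordinates u1, u3, u4 parametrize the plane of the conic; in them its matrix is
  diagonal with nonzero entries.\<close>

lemma is_conic_canon_conic:
  assumes "\<epsilon> \<noteq> 0" "e2 \<noteq> 0" "e3 \<noteq> 0" "d \<noteq> 0"
  shows "is_conic (canon_conic \<epsilon> e2 e3 d)"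
proof -
  define P0 :: "complex^4" where "P0 = vector [1, of_real d, 0, 0]"
  define P1 :: "complex^4" where "P1 = vector [0, 0, 1, 0]"
  define P2 :: "complex^4" where "P2 = vector [0, 0, 0, 1]"
  define M :: "complex^3^3" where
    "M = vector [vector [of_real (2 * \<epsilon> * d), 0, 0], vector [0, of_real e2, 0], vector [0, 0, of_real e3]]"
  have "cindep3 P0 P1 P2"
    by (auto simp: cindep3_def P0_def P1_def P2_def vec_eq_iff forall_4 vector_4)
  moreover have "transpose M = M" by (simp add: M_def transpose_def vec_eq_iff forall_3)
  moreover have "det M \<noteq> 0" using assms by (simp add: det_3 M_def)
  moreover have "u $ 2 = of_real d * u $ 1 \<and>
      of_real (2 * \<epsilon> * d) * (u $ 1)\<^sup>2 + of_real e2 * (u $ 3)\<^sup>2 + of_real e3 * (u $ 4)\<^sup>2 = 0 \<longleftrightarrow>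
    (\<exists>t :: complex^3. u = t$1 *s P0 + t$2 *s P1 + t$3 *s P2 \<and>
      (\<Sum>i\<in>UNIV. \<Sum>j\<in>UNIV. M$i$j * t$i * t$j) = 0)" (is "?L \<longleftrightarrow> (\<exists>t. ?R t)") for u
  proof
    assume ?L
    then show "\<exists>t. ?R t"
      by (intro exI[of _ "vector [u $ 1, u $ 3, u $ 4]"])
        (simp add: vec_eq_iff forall_4 vector_4 P0_def P1_def P2_def M_def sum_3 power2_eq_square mult_ac)
  next
    assume "\<exists>t. ?R t"
    then show ?L
      by (auto simp: vector_4 P0_def P1_def P2_def M_def sum_3 power2_eq_square mult_ac)
  qed
  ultimately show ?thesis unfolding is_conic_def canon_conic_def by blast
qed

lemma cv_mem_canon_conic:
  "cv Y \<in> canon_conic \<epsilon> e2 e3 d \<longleftrightarrow> Y \<noteq> 0 \<and> Y $ 2 = d * Y $ 1 \<and>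
    2 * \<epsilon> * d * (Y $ 1)\<^sup>2 + e2 * (Y $ 3)\<^sup>2 + e3 * (Y $ 4)\<^sup>2 = 0"
proof -
  have comp: "cv Y $ i = of_real (Y $ i)" for i by (simp add: cv_def)
  have "complex_of_real (2 * \<epsilon> * d) * (of_real (Y $ 1))\<^sup>2 + of_real e2 * (of_real (Y $ 3))\<^sup>2
      + of_real e3 * (of_real (Y $ 4))\<^sup>2
    = of_real (2 * \<epsilon> * d * (Y $ 1)\<^sup>2 + e2 * (Y $ 3)\<^sup>2 + e3 * (Y $ 4)\<^sup>2)" by simp
  then have eq1: "complex_of_real (2 * \<epsilon> * d) * (of_real (Y $ 1))\<^sup>2 + of_real e2 * (of_real (Y $ 3))\<^sup>2
      + of_real e3 * (of_real (Y $ 4))\<^sup>2 = 0 \<longleftrightarrow>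
    2 * \<epsilon> * d * (Y $ 1)\<^sup>2 + e2 * (Y $ 3)\<^sup>2 + e3 * (Y $ 4)\<^sup>2 = 0"
    by (simp only: of_real_eq_0_iff)
  have eq2: "complex_of_real (Y $ 2) = of_real d * of_real (Y $ 1) \<longleftrightarrow> Y $ 2 = d * Y $ 1"
    by (metis of_real_eq_iff of_real_mult)
  have eq3: "cv Y = 0 \<longleftrightarrow> Y = 0" by (simp add: cv_def vec_eq_iff)
  show ?thesis
    unfolding canon_conic_def mem_Collect_eq comp eq1 eq2 eq3 ..
qed

text \<open>The second hypothesis is injectivity in projective space, where \<open>f t\<close>
  matters only up to a factor.\<close>

lemma infinite_real_points_curve:
  fixes f :: "real \<Rightarrow> real^4"
  assumes mem: "\<And>t. f t \<noteq> 0 \<and> cv (f t) \<in> S" and inj: "\<And>t t' k. f t = k *\<^sub>R f t' \<Longrightarrow> t = t'"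
  shows "infinite (real_points S)"
proof -
  have "inj (\<lambda>t. span {f t})"
  proof (rule injI)
    fix t t' assume "span {f t} = span {f t'}"
    then have "f t \<in> span {f t'}" using span_base[of "f t" "{f t}"] by simp
    then show "t = t'" using inj by (auto simp: span_singleton)
  qed
  then have "infinite (range (\<lambda>t. span {f t}))"
    using finite_imageD infinite_UNIV_char_0 by blast
  moreover have "range (\<lambda>t. span {f t}) \<subseteq> real_points S"
    using mem unfolding real_points_def by blast
  ultimately show ?thesis using finite_subset by blast
qed

text \<open>With \<epsilon> = -1 the form -2 d u1^2 + e2 u3^2 + e3 u4^2 is indefinite as soon as
  \<open>e2\<close> or \<open>e3\<close> is 1. Each sign pattern gets an explicit curve of real
  points.\<close>

lemma real_conic_canon_conic:
  assumes e: "e2 \<in> {1, -1}" "e3 \<in> {1, -1}" "e2 = 1 \<or> e3 = 1" and "d > 0"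
  shows "real_conic (canon_conic (-1) e2 e3 d)"
proof -
  have "infinite (real_points (canon_conic (-1) e2 e3 d))"
  proof -
    consider "e2 = 1" "e3 = 1" | "e2 = 1" "e3 = -1" | "e2 = -1" "e3 = 1" using e by auto
    then show ?thesis
    proof cases
      case 1
      \<comment> \<open>The Pythagorean identity (1 - t^2)^2 + (2 t)^2 = (1 + t^2)^2 gives the
        points; \<open>m\<close> absorbs the coefficient 2 d.\<close>
      define m where "m = sqrt (2 * d)"
      have m: "m > 0" "m * m = 2 * d" using \<open>d > 0\<close> by (simp_all add: m_def)
      define f :: "real \<Rightarrow> real^4" where
        "f t = vector [(1 + t\<^sup>2) / m, d * (1 + t\<^sup>2) / m, 1 - t\<^sup>2, 2 * t]" for t
      show ?thesis
      proof (rule infinite_real_points_curve[of f])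
        fix t
        have f: "f t $ 1 = (1 + t\<^sup>2) / m" "f t $ 2 = d * f t $ 1" "f t $ 3 = 1 - t\<^sup>2" "f t $ 4 = 2 * t"
          by (simp_all add: f_def vector_4)
        have "1 + t\<^sup>2 > 0" by (simp add: add_pos_nonneg)
        then have "f t $ 1 \<noteq> 0" using m by (simp add: f)
        then have "f t \<noteq> 0" by auto
        moreover have "(f t $ 1)\<^sup>2 = (1 + t\<^sup>2)\<^sup>2 / (2 * d)"
          by (simp add: f(1) power_divide power2_eq_square[of m] m(2))
        then have "2 * d * (f t $ 1)\<^sup>2 = (1 + t\<^sup>2)\<^sup>2" using \<open>d > 0\<close> by simp
        then have "2 * (-1) * d * (f t $ 1)\<^sup>2 + 1 * (f t $ 3)\<^sup>2 + 1 * (f t $ 4)\<^sup>2 = 0"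
          by (simp add: f(3,4) power2_eq_square algebra_simps)
        ultimately show "f t \<noteq> 0 \<and> cv (f t) \<in> canon_conic (-1) e2 e3 d"
          unfolding cv_mem_canon_conic 1 using f(2) by blast
      next
        fix t t' k assume eq: "f t = k *\<^sub>R f t'"
        \<comment> \<open>This combination equals 2 at every parameter, which forces k = 1.\<close>
        have "m * f t $ 1 + f t $ 3 = k * (m * f t' $ 1 + f t' $ 3)" "f t $ 4 = k * f t' $ 4"
          by (simp_all add: eq algebra_simps)
        then show "t = t'" using m by (simp add: f_def vector_4)
      qed
    next
      case 2
      \<comment> \<open>Here (d t^2 + 1/2)^2 - (d t^2 - 1/2)^2 = 2 d t^2, and the constant
        difference of the last two coordinates will fix the projective factor.\<close>
      define f :: "real \<Rightarrow> real^4" where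
        "f t = vector [t, d * t, d * t\<^sup>2 + 1/2, d * t\<^sup>2 - 1/2]" for t
      show ?thesis
      proof (rule infinite_real_points_curve[of f])
        fix t
        have f: "f t $ 1 = t" "f t $ 2 = d * f t $ 1" "f t $ 3 = d * t\<^sup>2 + 1/2" "f t $ 4 = d * t\<^sup>2 - 1/2"
          by (simp_all add: f_def vector_4)
        have "f t $ 3 - f t $ 4 \<noteq> 0" by (simp add: f)
        then have "f t \<noteq> 0" by auto
        moreover have "2 * (-1) * d * (f t $ 1)\<^sup>2 + 1 * (f t $ 3)\<^sup>2 + (-1) * (f t $ 4)\<^sup>2 = 0"
          by (simp add: f power2_eq_square algebra_simps)
        ultimately show "f t \<noteq> 0 \<and> cv (f t) \<in> canon_conic (-1) e2 e3 d"
          unfolding cv_mem_canon_conic 2 using f(2) by blast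
      next
        fix t t' k assume eq: "f t = k *\<^sub>R f t'"
        have "f t $ 3 - f t $ 4 = k * (f t' $ 3 - f t' $ 4)" "f t $ 1 = k * f t' $ 1"
          by (simp_all add: eq algebra_simps)
        then show "t = t'" by (simp add: f_def vector_4)
      qed
    next
      case 3
      define f :: "real \<Rightarrow> real^4" where
        "f t = vector [t, d * t, d * t\<^sup>2 - 1/2, d * t\<^sup>2 + 1/2]" for t
      show ?thesis
      proof (rule infinite_real_points_curve[of f])
        fix t
        have f: "f t $ 1 = t" "f t $ 2 = d * f t $ 1" "f t $ 3 = d * t\<^sup>2 - 1/2" "f t $ 4 = d * t\<^sup>2 + 1/2"
          by (simp_all add: f_def vector_4)
        have "f t $ 3 - f t $ 4 \<noteq> 0" by (simp add: f)
        then have "f t \<noteq> 0" by auto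
        moreover have "2 * (-1) * d * (f t $ 1)\<^sup>2 + (-1) * (f t $ 3)\<^sup>2 + 1 * (f t $ 4)\<^sup>2 = 0"
          by (simp add: f power2_eq_square algebra_simps)
        ultimately show "f t \<noteq> 0 \<and> cv (f t) \<in> canon_conic (-1) e2 e3 d"
          unfolding cv_mem_canon_conic 3 using f(2) by blast
      next
        fix t t' k assume eq: "f t = k *\<^sub>R f t'"
        have "f t $ 3 - f t $ 4 = k * (f t' $ 3 - f t' $ 4)" "f t $ 1 = k * f t' $ 1"
          by (simp_all add: eq algebra_simps)
        then show "t = t'" by (simp add: f_def vector_4)
      qed
    qed
  qed
  then show ?thesis
    using is_conic_canon_conic[of "-1" e2 e3 d] e(1,2) \<open>d > 0\<close> unfolding real_conic_def by auto
qed

text \<open>In the plane of the conic the form is positive definite.\<close>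

lemma canon_conic_no_real_point:
  assumes "d > 0"
  shows "cv Y \<notin> canon_conic 1 1 1 d"
proof
  assume "cv Y \<in> canon_conic 1 1 1 d"
  then have "Y \<noteq> 0" "Y $ 2 = d * Y $ 1" and sum: "2 * d * (Y $ 1)\<^sup>2 + (Y $ 3)\<^sup>2 + (Y $ 4)\<^sup>2 = 0"
    unfolding cv_mem_canon_conic by simp_all
  have "2 * d * (Y $ 1)\<^sup>2 \<ge> 0" using assms by simp
  then have "2 * d * (Y $ 1)\<^sup>2 = 0 \<and> (Y $ 3)\<^sup>2 = 0 \<and> (Y $ 4)\<^sup>2 = 0"
    using sum assms zero_le_power2[of "Y $ 3"] zero_le_power2[of "Y $ 4"]
    by (intro conjI) linarith+
  then show False
    using \<open>Y \<noteq> 0\<close> \<open>Y $ 2 = d * Y $ 1\<close> assms by (simp add: vec_eq_iff forall_4)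
qed

text \<open>The only real point of such a line is (1, 0, 0, 0), and it lies off the plane u2 = d u1
  because d \<noteq> 0.\<close>

lemma canon_conic_Int_imaginary_line:
  assumes "d \<noteq> 0" "k \<in> {\<i>, - \<i>}"
  shows "cv Y \<notin> canon_conic \<epsilon> e2 e3 d \<inter> canon_line k"
proof
  assume "cv Y \<in> canon_conic \<epsilon> e2 e3 d \<inter> canon_line k"
  then have "Y \<noteq> 0" "Y $ 2 = d * Y $ 1" and l: "cv Y $ 2 = 0" "cv Y $ 4 = k * cv Y $ 3"
    unfolding Int_iff cv_mem_canon_conic by (simp_all add: canon_line_def)
  moreover have "Y $ 4 = 0" "Y $ 3 = 0" "Y $ 2 = 0"
    using l assms(2) by (auto simp: cv_def complex_eq_iff)
  ultimately show False using assms(1) by (simp add: vec_eq_iff forall_4)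
qed

text \<open>The two planes meet in u1 = u2 = 0, and on the line the remaining form e2 u3^2 + e3 u4^2
  vanishes identically; a single point is left.\<close>

lemma canon_conic_Int_line:
  assumes "d \<noteq> 0" "k \<noteq> 0" "e2 + e3 * k\<^sup>2 = 0"
  shows "canon_conic \<epsilon> e2 e3 d \<inter> canon_line (of_real k) = ppoint (vector [0, 0, 1, k])"
proof -
  have "u \<in> canon_conic \<epsilon> e2 e3 d \<inter> canon_line (of_real k) \<longleftrightarrow>
      u \<noteq> 0 \<and> u $ 1 = 0 \<and> u $ 2 = 0 \<and> u $ 4 = of_real k * u $ 3" for u
  proof -
    have "of_real e2 * z\<^sup>2 + of_real e3 * (of_real k * z)\<^sup>2 = of_real (e2 + e3 * k\<^sup>2) * z\<^sup>2" for z :: complex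
      by (simp add: power2_eq_square algebra_simps)
    then show ?thesis
      using assms unfolding canon_conic_def canon_line_def by auto
  qed
  moreover have "u \<in> ppoint (vector [0, 0, 1, k]) \<longleftrightarrow>
      u \<noteq> 0 \<and> u $ 1 = 0 \<and> u $ 2 = 0 \<and> u $ 4 = of_real k * u $ 3" for u
    by (auto simp: ppoint_def cv_def vec_eq_iff forall_4 vector_4 intro!: exI[of _ "u $ 3"])
  ultimately show ?thesis by blast
qed

lemma canon_line_Int_line:
  assumes "k \<noteq> 0"
  shows "canon_line k \<inter> canon_line (- k) = ppoint (vector [1, 0, 0, 0])"
proof -
  have "u \<in> canon_line k \<inter> canon_line (- k) \<longleftrightarrow> u \<noteq> 0 \<and> u $ 2 = 0 \<and> u $ 3 = 0 \<and> u $ 4 = 0" for u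
    using assms unfolding canon_line_def by (auto simp: eq_neg_iff_add_eq_0)
  moreover have "u \<in> ppoint (vector [1, 0, 0, 0]) \<longleftrightarrow> u \<noteq> 0 \<and> u $ 2 = 0 \<and> u $ 3 = 0 \<and> u $ 4 = 0" for u
    by (auto simp: ppoint_def cv_def vec_eq_iff forall_4 vector_4 intro!: exI[of _ "u $ 1"])
  ultimately show ?thesis by blast
qed

lemma ppoint_neq:
  assumes "Y \<noteq> 0" "\<And>c. cv Y \<noteq> c *s cv Z"
  shows "ppoint Y \<noteq> ppoint Z"
proof -
  have "cv Y \<in> ppoint Y"
    using assms(1) by (auto simp: ppoint_def cv_def vec_eq_iff intro!: exI[of _ 1])
  moreover have "cv Y \<notin> ppoint Z" using assms(2) by (simp add: ppoint_def)
  ultimately show ?thesis by blast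
qed

text \<open>Combines the canonical form contained in the sequence of the transformed pencil with the
  invariance of the base locus. The last entry \<open>s2\<close> then fixes \<open>e2\<close> and
  \<open>e3\<close> up to order.\<close>

lemma index_seq_equiv_imp_canonical_qsic:
  assumes "index_seq_equiv A B s0 [Wr \<epsilon>, Wr \<epsilon>] s1 [Bar, Bar] s2"
  obtains Q Q' r s e2 e3 where "projectivity Q Q'" "r < s" "e2 \<in> {1, -1}" "e3 \<in> {1, -1}"
    "s2 = 1 + of_bool (e2 = 1) + of_bool (e3 = 1)"
    "qsic A B = cmap Q ` qsic (canonA (of_int \<epsilon>) e2 e3) (canonB (of_int \<epsilon>) e2 e3 r s)"
proof -
  obtain A' B' where change: "pencil_basis_change A B A' B'"
    and idx: "index_seq A' B' s0 [Wr \<epsilon>, Wr \<epsilon>] s1 [Bar, Bar] s2"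
    using assms unfolding index_seq_equiv_def by blast
  obtain r s e2 e3 where "r < s" and canon: "canon_2_11 A' B' r s (of_int \<epsilon>) e2 e3"
    and s2: "s2 = 1 + of_bool (e2 = 1) + of_bool (e3 = 1)"
    using index_seq_imp_canon[OF idx] .
  obtain Q where Q: "invertible Q" "transpose Q ** A' ** Q = canonA (of_int \<epsilon>) e2 e3"
    "transpose Q ** B' ** Q = canonB (of_int \<epsilon>) e2 e3 r s" and e: "e2 \<in> {1, -1}" "e3 \<in> {1, -1}"
    using canon unfolding canon_2_11_def by blast
  obtain Q' where "Q ** Q' = mat 1" "Q' ** Q = mat 1" using Q(1) unfolding invertible_def by blast
  then interpret projectivity Q Q' by unfold_locales
  show ?thesis
    using that[OF projectivity_axioms \<open>r < s\<close> e s2]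
      qsic_cmap[of A' B'] qsic_pencil_basis_change[OF change] Q(2,3) by simp
qed

lemma qsic_real_lines:
  assumes "index_seq_equiv A B 2 [Wr (-1), Wr (-1)] 2 [Bar, Bar] 2"
  shows "\<exists>C L1 L2. qsic A B = C \<union> L1 \<union> L2 \<and> real_conic C \<and>
    is_real_line L1 \<and> is_real_line L2 \<and> L1 \<noteq> L2 \<and>
    (\<exists>Y1 Y2 Y3. Y1 \<noteq> 0 \<and> Y2 \<noteq> 0 \<and> Y3 \<noteq> 0 \<and>
      C \<inter> L1 = ppoint Y1 \<and> C \<inter> L2 = ppoint Y2 \<and> L1 \<inter> L2 = ppoint Y3 \<and>
      ppoint Y1 \<noteq> ppoint Y2 \<and> ppoint Y1 \<noteq> ppoint Y3 \<and> ppoint Y2 \<noteq> ppoint Y3)"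
proof -
  obtain Q Q' r s e2 e3 where "projectivity Q Q'" and "r < s"
    and e: "e2 \<in> {1, -1}" "e3 \<in> {1, -1}" and count: "2 = (1 :: nat) + of_bool (e2 = 1) + of_bool (e3 = 1)"
    and qsic: "qsic A B = cmap Q ` qsic (canonA (of_int (-1)) e2 e3) (canonB (of_int (-1)) e2 e3 r s)"
    using index_seq_equiv_imp_canonical_qsic[OF assms] .
  interpret projectivity Q Q' by fact
  \<comment> \<open>Exactly one of the two signs is +1, so the lines are u4 = u3 and u4 = -
    u3.\<close>
  have e_sum: "e2 + e3 = 0" "e2 = 1 \<or> e3 = 1" using e count by auto
  define d where "d = 2 * (s - r)"
  have "d > 0" using \<open>r < s\<close> by (simp add: d_def)
  define C where "C = canon_conic (-1) e2 e3 d"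
  define L1 where "L1 = canon_line (of_real 1)"
  define L2 where "L2 = canon_line (of_real (-1))"
  \<comment> \<open>\<open>Y1\<close> and \<open>Y2\<close> lie on the line u1 = u2 = 0 common to
    the two planes; \<open>Y3\<close> is the point where the two lines cross.\<close>
  define Y1 :: "real^4" where "Y1 = vector [0, 0, 1, 1]"
  define Y2 :: "real^4" where "Y2 = vector [0, 0, 1, -1]"
  define Y3 :: "real^4" where "Y3 = vector [1, 0, 0, 0]"
  have "complex_of_real e2 + of_real e3 * 1\<^sup>2 = 0"
    using e_sum(1) by (metis mult.right_neutral of_real_0 of_real_add one_power2)
  then have canonical: "qsic A B = cmap Q ` C \<union> cmap Q ` L1 \<union> cmap Q ` L2"
    unfolding qsic using qsic_canon[of "-1" e3 e2 1 r s] e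
    by (auto simp: C_def L1_def L2_def d_def image_Un)
  have real: "real_conic (cmap Q ` C)" "is_real_line (cmap Q ` L1)" "is_real_line (cmap Q ` L2)"
    unfolding C_def L1_def L2_def using real_conic_canon_conic[OF e e_sum(2) \<open>d > 0\<close>]
    by (simp_all only: real_conic_cmap is_real_line_cmap is_real_line_canon_line)
  have "cmap Q ` L1 \<noteq> cmap Q ` L2"
    unfolding inj_image_eq_iff[OF inj_cmap] L1_def L2_def canon_line_inject by simp
  have "C \<inter> L1 = ppoint Y1" "C \<inter> L2 = ppoint Y2" "L1 \<inter> L2 = ppoint Y3"
    unfolding C_def L1_def L2_def Y1_def Y2_def Y3_def
    using canon_conic_Int_line[of d 1 e2 e3 "-1"] canon_conic_Int_line[of d "-1" e2 e3 "-1"]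
      canon_line_Int_line[of 1] \<open>d > 0\<close> e_sum(1) by simp_all
  then have meet: "cmap Q ` C \<inter> cmap Q ` L1 = ppoint (Q *v Y1)"
    "cmap Q ` C \<inter> cmap Q ` L2 = ppoint (Q *v Y2)" "cmap Q ` L1 \<inter> cmap Q ` L2 = ppoint (Q *v Y3)"
    by (simp_all add: ppoint_cmap image_Int[OF inj_cmap, symmetric])
  have nz: "Y1 \<noteq> 0" "Y2 \<noteq> 0" "Y3 \<noteq> 0"
    by (auto simp: Y1_def Y2_def Y3_def vec_eq_iff forall_4 vector_4)
  have "cv Y1 \<noteq> c *s cv Y2" "cv Y1 \<noteq> c *s cv Y3" "cv Y2 \<noteq> c *s cv Y3" for c
    by (auto simp: Y1_def Y2_def Y3_def cv_def vec_eq_iff forall_4 vector_4)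
  then have "ppoint Y1 \<noteq> ppoint Y2" "ppoint Y1 \<noteq> ppoint Y3" "ppoint Y2 \<noteq> ppoint Y3"
    using ppoint_neq[OF nz(1)] ppoint_neq[OF nz(2)] by simp_all
  then have "ppoint (Q *v Y1) \<noteq> ppoint (Q *v Y2)" "ppoint (Q *v Y1) \<noteq> ppoint (Q *v Y3)"
    "ppoint (Q *v Y2) \<noteq> ppoint (Q *v Y3)"
    by (simp_all add: ppoint_cmap inj_image_eq_iff[OF inj_cmap])
  moreover have "Q *v Y1 \<noteq> 0" "Q *v Y2 \<noteq> 0" "Q *v Y3 \<noteq> 0"
    using nz by (simp_all add: matrix_eq_0)
  ultimately show ?thesis
    using canonical real meet \<open>cmap Q ` L1 \<noteq> cmap Q ` L2\<close>
    by (intro exI[of _ "cmap Q ` C"] exI[of _ "cmap Q ` L1"] exI[of _ "cmap Q ` L2"]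
        exI[of _ "Q *v Y1"] exI[of _ "Q *v Y2"] exI[of _ "Q *v Y3"] conjI)
qed

text \<open>The last entry 3 gives e2 = e3 = 1 and hence imaginary lines for either \<epsilon>; the
  sign affects only the conic, so both cases share one argument.\<close>

lemma qsic_conjugate_lines:
  assumes "index_seq_equiv A B 1 [Wr \<epsilon>, Wr \<epsilon>] 1 [Bar, Bar] 3" and "\<epsilon> \<in> {1, -1}"
  shows "\<exists>C L1 L2. qsic A B = C \<union> L1 \<union> L2 \<and>
    (\<epsilon> = -1 \<longrightarrow> real_conic C) \<and> (\<epsilon> = 1 \<longrightarrow> imaginary_conic C) \<and> conj_lines L1 L2 \<and>
    \<not> (\<exists>Y. Y \<noteq> 0 \<and> cv Y \<in> C \<inter> (L1 \<union> L2))"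
proof -
  obtain Q Q' r s e2 e3 where "projectivity Q Q'" and "r < s"
    and e: "e2 \<in> {1, -1}" "e3 \<in> {1, -1}" and count: "3 = (1 :: nat) + of_bool (e2 = 1) + of_bool (e3 = 1)"
    and qsic: "qsic A B = cmap Q ` qsic (canonA (of_int \<epsilon>) e2 e3) (canonB (of_int \<epsilon>) e2 e3 r s)"
    using index_seq_equiv_imp_canonical_qsic[OF assms(1)] .
  interpret projectivity Q Q' by fact
  have e1: "e2 = 1" "e3 = 1" using count by (auto simp: of_bool_def split: if_splits)
  define d where "d = 2 * (s - r)"
  have "d > 0" using \<open>r < s\<close> by (simp add: d_def)
  define C where "C = canon_conic (of_int \<epsilon>) 1 1 d"
  have canonical: "qsic A B = cmap Q ` C \<union> cmap Q ` canon_line \<i> \<union> cmap Q ` canon_line (- \<i>)"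
    unfolding qsic e1 using qsic_canon[of "of_int \<epsilon>" 1 1 \<i> r s] assms(2)
    by (auto simp: C_def d_def image_Un)
  have "conj_lines (cmap Q ` canon_line \<i>) (cmap Q ` canon_line (- \<i>))"
    by (rule conj_lines_cmap[OF conj_lines_canon_line])
  moreover have "real_conic (cmap Q ` C)" if "\<epsilon> = -1"
    using that real_conic_cmap[OF real_conic_canon_conic[of 1 1 d]] \<open>d > 0\<close> by (simp add: C_def)
  moreover have "imaginary_conic (cmap Q ` C)" if "\<epsilon> = 1"
  proof -
    have "cv Y \<notin> cmap Q ` C" for Y
      using canon_conic_no_real_point[OF \<open>d > 0\<close>] that by (simp add: cv_mem_cmap_image C_def)
    then have "real_points (cmap Q ` C) = {}" unfolding real_points_def by blast
    then show ?thesis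
      using is_conic_cmap[OF is_conic_canon_conic[of 1 1 1 d]] \<open>d > 0\<close> that
      by (simp add: imaginary_conic_def C_def)
  qed
  moreover have "cv Y \<notin> cmap Q ` C \<inter> (cmap Q ` canon_line \<i> \<union> cmap Q ` canon_line (- \<i>))" for Y
    using canon_conic_Int_imaginary_line[of d \<i> "Q' *v Y" "of_int \<epsilon>" 1 1]
      canon_conic_Int_imaginary_line[of d "- \<i>" "Q' *v Y" "of_int \<epsilon>" 1 1] \<open>d > 0\<close>
    by (auto simp: cv_mem_cmap_image C_def)
  ultimately show ?thesis using canonical by blast
qed

theorem theorem17:
  fixes A B :: "real^4^4"
  assumes symA: "transpose A = A"
    and symB: "transpose B = B"
    and f_nonzero: "pencil_poly A B \<noteq> 0"
    and A_nonsing: "det A \<noteq> 0"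
    and segre: "two_double_roots_segre_2_11 A B"
  shows "(index_seq_equiv A B 2 [Wr (-1), Wr (-1)] 2 [Bar, Bar] 2 \<or>
          index_seq_equiv A B 1 [Wr 1, Wr 1] 1 [Bar, Bar] 3 \<or>
          index_seq_equiv A B 1 [Wr (-1), Wr (-1)] 1 [Bar, Bar] 3)
   \<and> (index_seq_equiv A B 2 [Wr (-1), Wr (-1)] 2 [Bar, Bar] 2 \<longrightarrow>
        (\<exists>C L1 L2. qsic A B = C \<union> L1 \<union> L2 \<and> real_conic C \<and>
           is_real_line L1 \<and> is_real_line L2 \<and> L1 \<noteq> L2 \<and>
           (\<exists>Y1 Y2 Y3. Y1 \<noteq> 0 \<and> Y2 \<noteq> 0 \<and> Y3 \<noteq> 0 \<and>
              C \<inter> L1 = ppoint Y1 \<and> C \<inter> L2 = ppoint Y2 \<and> L1 \<inter> L2 = ppoint Y3 \<and>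
              ppoint Y1 \<noteq> ppoint Y2 \<and> ppoint Y1 \<noteq> ppoint Y3 \<and> ppoint Y2 \<noteq> ppoint Y3)))
   \<and> (index_seq_equiv A B 1 [Wr (-1), Wr (-1)] 1 [Bar, Bar] 3 \<longrightarrow>
        (\<exists>C L1 L2. qsic A B = C \<union> L1 \<union> L2 \<and> real_conic C \<and> conj_lines L1 L2 \<and>
           \<not> (\<exists>Y. Y \<noteq> 0 \<and> cv Y \<in> C \<inter> (L1 \<union> L2))))
   \<and> (index_seq_equiv A B 1 [Wr 1, Wr 1] 1 [Bar, Bar] 3 \<longrightarrow>
        (\<exists>C L1 L2. qsic A B = C \<union> L1 \<union> L2 \<and> imaginary_conic C \<and> conj_lines L1 L2 \<and>
           \<not> (\<exists>Y. Y \<noteq> 0 \<and> cv Y \<in> C \<inter> (L1 \<union> L2))))"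
proof (intro conjI impI)
  obtain r s \<epsilon> e2 e3 where "canon_2_11 A B r s \<epsilon> e2 e3"
    using segre_2_11_imp_canon[OF symA symB A_nonsing segre] by blast
  then show "index_seq_equiv A B 2 [Wr (-1), Wr (-1)] 2 [Bar, Bar] 2 \<or>
      index_seq_equiv A B 1 [Wr 1, Wr 1] 1 [Bar, Bar] 3 \<or>
      index_seq_equiv A B 1 [Wr (-1), Wr (-1)] 1 [Bar, Bar] 3"
    by (rule canon_index_seq_equiv)
next
  assume "index_seq_equiv A B 2 [Wr (-1), Wr (-1)] 2 [Bar, Bar] 2"
  then show "\<exists>C L1 L2. qsic A B = C \<union> L1 \<union> L2 \<and> real_conic C \<and>
      is_real_line L1 \<and> is_real_line L2 \<and> L1 \<noteq> L2 \<and>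
      (\<exists>Y1 Y2 Y3. Y1 \<noteq> 0 \<and> Y2 \<noteq> 0 \<and> Y3 \<noteq> 0 \<and>
        C \<inter> L1 = ppoint Y1 \<and> C \<inter> L2 = ppoint Y2 \<and> L1 \<inter> L2 = ppoint Y3 \<and>
        ppoint Y1 \<noteq> ppoint Y2 \<and> ppoint Y1 \<noteq> ppoint Y3 \<and> ppoint Y2 \<noteq> ppoint Y3)"
    by (rule qsic_real_lines)
next
  assume "index_seq_equiv A B 1 [Wr (-1), Wr (-1)] 1 [Bar, Bar] 3"
  then show "\<exists>C L1 L2. qsic A B = C \<union> L1 \<union> L2 \<and> real_conic C \<and> conj_lines L1 L2 \<and>
      \<not> (\<exists>Y. Y \<noteq> 0 \<and> cv Y \<in> C \<inter> (L1 \<union> L2))"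
    using qsic_conjugate_lines[of A B "-1"] by simp
next
  assume "index_seq_equiv A B 1 [Wr 1, Wr 1] 1 [Bar, Bar] 3"
  then show "\<exists>C L1 L2. qsic A B = C \<union> L1 \<union> L2 \<and> imaginary_conic C \<and> conj_lines L1 L2 \<and>
      \<not> (\<exists>Y. Y \<noteq> 0 \<and> cv Y \<in> C \<inter> (L1 \<union> L2))"
    using qsic_conjugate_lines[of A B 1] by simp
qed

end
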